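(* Let $(X,d)$ be a complete CAT$(-1)$ space having the convex hull finite property and $K$ a nonempty closed convex subset of $X$. Suppose that $f\colon K\times K\to\mathbb{R}$ satisfies the following conditions: (a) $f(x,x)=0$ for all $x\in K$; (b) $f(x,y)+f(y,x)\le 0$ for all $x,y\in K$; (c) for every $x\in K$, the function $f(x,\cdot)\colon K\to\mathbb{R}$ is lower semicontinuous and convex; (d) for every $y\in K$, the function $f(\cdot,y)\colon K\to\mathbb{R}$ is upper hemicontinuous. Define a set-valued mapping $L_f\colon X\to 2^K$ by \[ L_f x=\left\{z\in K \;\middle|\; \inf_{y\in K}\bigl(f(z,y)+\cosh d(x,y)-\cosh d(x,z)\bigr)\ge 0\right\} \] for all $x\in X$. Then the following hold: (i) $D(L_f)=X$, i.e. $L_fx\neq\emptyset$ for every $x\in X$; (ii) $L_f$ is single-valued and (regarded as a mapping of $X$ into itself) firmly hyperbolically nonspreading; (iii) $\operatorname{Equil} f=F(L_f)$, and thus $\operatorname{Equil} f$ is closed and convex.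
   Context: CAT$(-1)$ spaces: a metric space $(X,d)$ in which any two points $x,y$ are joined by a geodesic (an isometric map $c\colon[0,d(x,y)]\to X$ with $c(0)=x$, $c(d(x,y))=y$), geodesics being unique with image denoted $[x,y]$, and such that for every geodesic triangle in $X$ with comparison triangle (same side lengths) in the hyperbolic plane $\mathbb{H}^2$ of curvature $-1$, distances between points of the triangle are at most the distances between the corresponding comparison points. Every CAT$(-1)$ space is a CAT$(0)$ space. For $x,y\in X$ and $t\in[0,1]$, $tx\oplus(1-t)y$ denotes the unique point $z\in[x,y]$ with $d(x,z)=(1-t)d(x,y)$ and $d(y,z)=t\,d(x,y)$. A subset $K$ is convex if $tx\oplus(1-t)y\in K$ for all $x,y\in K$, $t\in[0,1]$. A function $g\colon K\to\mathbb{R}$ is lower semicontinuous if $\{x\in K\mid g(x)\le a\}$ is closed for all $a\in\mathbb{R}$; convex if $g(\alpha x\oplus(1-\alpha)y)\le\alpha g(x)+(1-\alpha)g(y)$ for all $x,y\in K$, $\alpha\in(0,1)$; upper hemicontinuous if $g(x)\ge\limsup_{t\to0^+}g((1-t)x\oplus ty)$ for all $x,y\in K$. Convex hull: for $E\subset X$, $\operatorname{co}E=\bigcup_{n=0}^\infty X_n$, where $X_0=E$ and $X_n=\{tu\oplus(1-t)v\mid u,v\in X_{n-1},\ t\in[0,1]\}$; $\operatorname{clco}E$ is the closure of $\operatorname{co}E$. The space $X$ has the convex hull finite property if for every nonempty finite subset $E$ of $X$, every continuous mapping of $\operatorname{clco}E$ into itself has a fixed point. A mapping $T\colon X\to X$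 is firmly hyperbolically nonspreading if \[ (\cosh d(x,Tx)+\cosh d(y,Ty))\cosh d(Tx,Ty)\le\cosh d(Tx,y)+\cosh d(x,Ty) \] for all $x,y\in X$. $F(T)$ denotes the set of fixed points of $T$. The set of solutions of the equilibrium problem for $f$ is $\operatorname{Equil}f=\{z\in K\mid\inf_{y\in K}f(z,y)\ge0\}$. *)

theory Defs
  imports "HOL-Analysis.Analysis"
begin

subsection \<open>The hyperbolic plane\<close>

text \<open>
  The hyperboloid model: the upper sheet of \<open>x\<^sup>2 + y\<^sup>2 - z\<^sup>2 = -1\<close> in Minkowski space, with the
  distance given by \<open>cosh (dist u v) = - (u | v)\<close>, where \<open>(u | v)\<close> is the Lorentz form.
  This is the simply connected surface of constant curvature \<open>-1\<close>.
\<close>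

fun lorentz :: "real \<times> real \<times> real \<Rightarrow> real \<times> real \<times> real \<Rightarrow> real" where
  "lorentz (x1, y1, z1) (x2, y2, z2) = x1 * x2 + y1 * y2 - z1 * z2"

typedef hyp_plane = "{u :: real \<times> real \<times> real. lorentz u u = -1 \<and> snd (snd u) > 0}"
  by (rule exI[of _ "(0, 0, 1)"]) simp

lemma lorentz_le:
  assumes u: "lorentz u u = -1" "snd (snd u) > 0" and v: "lorentz v v = -1" "snd (snd v) > 0"
  shows "- lorentz u v \<ge> 1" and "- lorentz u v = 1 \<Longrightarrow> u = v"
proof -
  obtain a b c where U: "u = (a, b, c)" by (cases u)
  obtain d e f where V: "v = (d, e, f)" by (cases v)
  have c2: "c * c = 1 + a * a + b * b" and f2: "f * f = 1 + d * d + e * e"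
    using u v by (auto simp: U V)
  have cf: "c * f > 0" using u v by (simp add: U V)
  have "(c * f)\<^sup>2 = (c * c) * (f * f)" by (simp add: power2_eq_square)
  also have "\<dots> = (1 + a * d + b * e)\<^sup>2 + ((a - d)\<^sup>2 + (b - e)\<^sup>2 + (a * e - b * d)\<^sup>2)"
    unfolding c2 f2 by (simp add: power2_eq_square algebra_simps)
  finally have key: "(c * f)\<^sup>2 = (1 + a * d + b * e)\<^sup>2 + ((a - d)\<^sup>2 + (b - e)\<^sup>2 + (a * e - b * d)\<^sup>2)" .
  then have "(1 + a * d + b * e)\<^sup>2 \<le> (c * f)\<^sup>2" by simp
  then have "1 + a * d + b * e \<le> c * f" using cf by (meson less_imp_le power2_le_imp_le)
  then show "- lorentz u v \<ge> 1" by (simp add: U V)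
  assume "- lorentz u v = 1"
  then have "c * f = 1 + a * d + b * e" by (simp add: U V)
  then have "(a - d)\<^sup>2 + (b - e)\<^sup>2 + (a * e - b * d)\<^sup>2 = 0" using key by simp
  then have "a = d" "b = e"
    by (smt (verit) zero_le_power2 zero_eq_power2)+
  moreover from this have "c\<^sup>2 = f\<^sup>2" using c2 f2 by (simp add: power2_eq_square)
  then have "c = f" using u v by (simp add: U V)
  ultimately show "u = v" by (simp add: U V)
qed

lemma lorentz_gram:
  assumes "lorentz u u = -1" "lorentz v v = -1" "lorentz w w = -1"
  shows "(lorentz u w + lorentz u v * lorentz v w)\<^sup>2
           \<le> ((lorentz u v)\<^sup>2 - 1) * ((lorentz v w)\<^sup>2 - 1)"
proof -
  obtain a b c where U: "u = (a, b, c)" by (cases u)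
  obtain d e f where V: "v = (d, e, f)" by (cases v)
  obtain g h i where W: "w = (g, h, i)" by (cases w)
  have "c * c = 1 + a * a + b * b" "f * f = 1 + d * d + e * e" "i * i = 1 + g * g + h * h"
    using assms by (auto simp: U V W)
  then have "((lorentz u v)\<^sup>2 - 1) * ((lorentz v w)\<^sup>2 - 1)
      - (lorentz u w + lorentz u v * lorentz v w)\<^sup>2
      = (a * (e * i - f * h) - b * (d * i - f * g) + c * (d * h - e * g))\<^sup>2"
    unfolding U V W lorentz.simps by algebra
  then show ?thesis
    by (smt (verit) zero_le_power2)
qed

instantiation hyp_plane :: metric_space
begin

definition dist_hyp_plane :: "hyp_plane \<Rightarrow> hyp_plane \<Rightarrow> real" where
  "dist_hyp_plane u v = arcosh (- lorentz (Rep_hyp_plane u) (Rep_hyp_plane v))"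

definition uniformity_hyp_plane :: "(hyp_plane \<times> hyp_plane) filter" where
  "uniformity_hyp_plane = (INF e\<in>{0<..}. principal {(x, y). dist x y < e})"

definition open_hyp_plane :: "hyp_plane set \<Rightarrow> bool" where
  "open_hyp_plane U \<longleftrightarrow> (\<forall>x\<in>U. \<forall>\<^sub>F (x', y) in uniformity. x' = x \<longrightarrow> y \<in> U)"

instance
proof
  fix u v w :: hyp_plane
  have R: "lorentz (Rep_hyp_plane p) (Rep_hyp_plane p) = -1" "snd (snd (Rep_hyp_plane p)) > 0" for p
    using Rep_hyp_plane[of p] by auto
  have ge: "- lorentz (Rep_hyp_plane p) (Rep_hyp_plane q) \<ge> 1" for p q
    using lorentz_le(1) R by blast
  show "dist u v = 0 \<longleftrightarrow> u = v"
    using lorentz_le(2)[OF R R, of u v] R(1)[of u] ge[of u v] Rep_hyp_plane_inject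
    unfolding dist_hyp_plane_def by (metis arcosh_eq_0_iff_real minus_minus)
  define A where "A = - lorentz (Rep_hyp_plane u) (Rep_hyp_plane w)"
  define B where "B = - lorentz (Rep_hyp_plane w) (Rep_hyp_plane v)"
  define C where "C = - lorentz (Rep_hyp_plane u) (Rep_hyp_plane v)"
  have ABC: "A \<ge> 1" "B \<ge> 1" "C \<ge> 1" unfolding A_def B_def C_def by (rule ge)+
  have sym: "lorentz p q = lorentz q p" for p q
    by (cases p; cases q) (simp add: algebra_simps)
  have "(C - A * B)\<^sup>2 = (- C + A * B)\<^sup>2" by (simp add: power2_commute)
  also have "\<dots> \<le> (A\<^sup>2 - 1) * (B\<^sup>2 - 1)"
    using lorentz_gram[OF R(1)[of u] R(1)[of w] R(1)[of v]] by (simp add: A_def B_def C_def)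
  finally have "C - A * B \<le> sqrt ((A\<^sup>2 - 1) * (B\<^sup>2 - 1))"
    by (rule real_le_rsqrt)
  then have "C \<le> cosh (arcosh A + arcosh B)"
    using ABC by (simp add: cosh_add sinh_arcosh_real real_sqrt_mult)
  then have "cosh (arcosh C) \<le> cosh (arcosh A + arcosh B)"
    using ABC by simp
  then have "arcosh C \<le> arcosh A + arcosh B"
    using ABC by (subst (asm) cosh_real_nonneg_le_iff) auto
  then show "dist u v \<le> dist u w + dist v w"
    unfolding dist_hyp_plane_def A_def B_def C_def by (simp add: sym)
qed (simp_all add: uniformity_hyp_plane_def open_hyp_plane_def)

end


subsection \<open>Geodesics and CAT(-1) spaces\<close>

text \<open>
  The space \<open>X\<close> is the universe of a type of class \<open>metric_space\<close>.
  Only the values of \<open>c\<close> on \<open>{0..dist x y}\<close> matter.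
\<close>

definition geodesic :: "(real \<Rightarrow> 'a::metric_space) \<Rightarrow> 'a \<Rightarrow> 'a \<Rightarrow> bool" where
  "geodesic c x y \<longleftrightarrow> c 0 = x \<and> c (dist x y) = y \<and>
     (\<forall>s\<in>{0..dist x y}. \<forall>t\<in>{0..dist x y}. dist (c s) (c t) = \<bar>s - t\<bar>)"

definition uniquely_geodesic :: "'a::metric_space itself \<Rightarrow> bool" where
  "uniquely_geodesic _ \<longleftrightarrow> (\<forall>x y :: 'a. (\<exists>c. geodesic c x y) \<and>
     (\<forall>c c'. geodesic c x y \<and> geodesic c' x y \<longrightarrow> (\<forall>t\<in>{0..dist x y}. c t = c' t)))"

definition geo_segment :: "'a::metric_space \<Rightarrow> 'a \<Rightarrow> 'a set" where
  "geo_segment x y = {z. \<exists>c. geodesic c x y \<and> z \<in> c ` {0..dist x y}}"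

definition comparison_triangle ::
  "'a::metric_space \<Rightarrow> 'a \<Rightarrow> 'a \<Rightarrow> hyp_plane \<Rightarrow> hyp_plane \<Rightarrow> hyp_plane \<Rightarrow> bool" where
  "comparison_triangle p q r p' q' r' \<longleftrightarrow>
     dist p' q' = dist p q \<and> dist q' r' = dist q r \<and> dist r' p' = dist r p"

definition comparison_on_side ::
  "'a::metric_space \<Rightarrow> 'a \<Rightarrow> hyp_plane \<Rightarrow> hyp_plane \<Rightarrow> 'a \<Rightarrow> hyp_plane \<Rightarrow> bool" where
  "comparison_on_side p q p' q' x x' \<longleftrightarrow>
     x \<in> geo_segment p q \<and> x' \<in> geo_segment p' q' \<and> dist p' x' = dist p x"

definition comparison_point ::
  "'a::metric_space \<Rightarrow> 'a \<Rightarrow> 'a \<Rightarrow> hyp_plane \<Rightarrow> hyp_plane \<Rightarrow> hyp_plane \<Rightarrow> 'a \<Rightarrow> hyp_plane \<Rightarrow> bool" where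
  "comparison_point p q r p' q' r' x x' \<longleftrightarrow>
     comparison_on_side p q p' q' x x' \<or>
     comparison_on_side q r q' r' x x' \<or>
     comparison_on_side r p r' p' x x'"

definition CAT_minus1 :: "'a::metric_space itself \<Rightarrow> bool" where
  "CAT_minus1 _ \<longleftrightarrow> uniquely_geodesic TYPE('a) \<and>
     (\<forall>(p::'a) q r p' q' r'. comparison_triangle p q r p' q' r' \<longrightarrow>
       (\<forall>x x' y y'. comparison_point p q r p' q' r' x x' \<and> comparison_point p q r p' q' r' y y'
          \<longrightarrow> dist x y \<le> dist x' y'))"


subsection \<open>Convexity in geodesic spaces\<close>

text \<open>
  \<open>geo_comb t x y\<close> is \<open>t x \<oplus> (1 - t) y\<close>: the weight \<open>t\<close> belongs to \<open>x\<close>, so that \<open>t = 1\<close> gives \<open>x\<close>.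
\<close>

definition geo_comb :: "real \<Rightarrow> 'a::metric_space \<Rightarrow> 'a \<Rightarrow> 'a" where
  "geo_comb t x y =
     (THE z. z \<in> geo_segment x y \<and> dist x z = (1 - t) * dist x y \<and> dist y z = t * dist x y)"

definition geo_convex :: "'a::metric_space set \<Rightarrow> bool" where
  "geo_convex K \<longleftrightarrow> (\<forall>x\<in>K. \<forall>y\<in>K. \<forall>t\<in>{0..1}. geo_comb t x y \<in> K)"

definition lsc_on :: "'a::metric_space set \<Rightarrow> ('a \<Rightarrow> real) \<Rightarrow> bool" where
  "lsc_on K g \<longleftrightarrow> (\<forall>a. closedin (top_of_set K) {x\<in>K. g x \<le> a})"

definition geo_convex_on :: "'a::metric_space set \<Rightarrow> ('a \<Rightarrow> real) \<Rightarrow> bool" where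
  "geo_convex_on K g \<longleftrightarrow>
     (\<forall>x\<in>K. \<forall>y\<in>K. \<forall>\<alpha>\<in>{0<..<1}. g (geo_comb \<alpha> x y) \<le> \<alpha> * g x + (1 - \<alpha>) * g y)"

definition upper_hemicontinuous_on :: "'a::metric_space set \<Rightarrow> ('a \<Rightarrow> real) \<Rightarrow> bool" where
  "upper_hemicontinuous_on K g \<longleftrightarrow>
     (\<forall>x\<in>K. \<forall>y\<in>K. Limsup (at_right 0) (\<lambda>t. ereal (g (geo_comb (1 - t) x y))) \<le> ereal (g x))"

primrec hull_stage :: "'a::metric_space set \<Rightarrow> nat \<Rightarrow> 'a set" where
  "hull_stage E 0 = E"
| "hull_stage E (Suc n) =
     {geo_comb t u v | t u v. u \<in> hull_stage E n \<and> v \<in> hull_stage E n \<and> t \<in> {0..1}}"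

definition geo_hull :: "'a::metric_space set \<Rightarrow> 'a set" where
  "geo_hull E = (\<Union>n. hull_stage E n)"

definition closed_geo_hull :: "'a::metric_space set \<Rightarrow> 'a set" where
  "closed_geo_hull E = closure (geo_hull E)"

definition convex_hull_finite_property :: "'a::metric_space itself \<Rightarrow> bool" where
  "convex_hull_finite_property _ \<longleftrightarrow>
     (\<forall>(E::'a set) h. finite E \<and> E \<noteq> {} \<and> continuous_on (closed_geo_hull E) h \<and>
        h ` closed_geo_hull E \<subseteq> closed_geo_hull E \<longrightarrow> (\<exists>x\<in>closed_geo_hull E. h x = x))"


subsection \<open>Mappings and equilibrium problems\<close>

definition firmly_hyperbolically_nonspreading :: "('a::metric_space \<Rightarrow> 'a) \<Rightarrow> bool" where
  "firmly_hyperbolically_nonspreading T \<longleftrightarrow>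
     (\<forall>x y. (cosh (dist x (T x)) + cosh (dist y (T y))) * cosh (dist (T x) (T y))
              \<le> cosh (dist (T x) y) + cosh (dist x (T y)))"

definition fixed_points :: "('a \<Rightarrow> 'a) \<Rightarrow> 'a set" where
  "fixed_points T = {x. T x = x}"

text \<open>
  A bifunction on \<open>K\<close> is a total function of which only the values on \<open>K \<times> K\<close> are used.
  The infima are taken in the extended reals, since they may be \<open>-\<infinity>\<close>.
\<close>

definition Equil :: "'a::metric_space set \<Rightarrow> ('a \<Rightarrow> 'a \<Rightarrow> real) \<Rightarrow> 'a set" where
  "Equil K f = {z\<in>K. (INF y\<in>K. ereal (f z y)) \<ge> 0}"

definition resolvent :: "'a::metric_space set \<Rightarrow> ('a \<Rightarrow> 'a \<Rightarrow> real) \<Rightarrow> 'a \<Rightarrow> 'a set" where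
  "resolvent K f x =
     {z\<in>K. (INF y\<in>K. ereal (f z y + cosh (dist x y) - cosh (dist x z))) \<ge> 0}"

definition effective_domain :: "('a \<Rightarrow> 'b set) \<Rightarrow> 'a set" where
  "effective_domain L = {x. L x \<noteq> {}}"

text \<open>Single-valued means that every value is a singleton; \<open>the_elem \<circ> L\<close> is then the underlying map.\<close>

definition single_valued_map :: "('a \<Rightarrow> 'b set) \<Rightarrow> bool" where
  "single_valued_map L \<longleftrightarrow> (\<forall>x. is_singleton (L x))"

end

theory Submission
  imports Defs
begin

text \<open>
  Write \<open>D = d(x, y)\<close> and \<open>m = t x \<oplus> (1 - t) y\<close>. Everything that is needed about curvature is one
  inequality,
  \<open>sinh D * cosh d(p, m) \<le> sinh (t D) * cosh d(p, x) + sinh ((1 - t) D) * cosh d(p, y)\<close>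
  (\<open>CAT_minus1_cosh_inequality\<close>). In the hyperboloid model it is an equality, because the geodesic
  from \<open>x\<close> to \<open>y\<close> is the normalised combination of two vectors and \<open>- cosh d\<close> is the
  Lorentz form; the comparison axiom turns it into an inequality in the space itself. It makes
  \<open>cosh d(p, \<cdot>)\<close> convex, it gives a uniform convexity estimate at midpoints, and it shows that
  \<open>t x \<oplus> (1 - t) y\<close> depends continuously on \<open>t\<close> and \<open>x\<close>.

  \<^emph>\<open>Resolvents exist.\<close> Let \<open>L_f x\<close> stand for \<open>resolvent K f x\<close> and put
  \<open>\<phi> = cosh d(x, \<cdot>)\<close>. By Minty's argument (\<open>Minty\<close>) the points of \<open>L_f x\<close> are the solutions of the dual inequalities \<open>f y z + \<phi> z \<le> \<phi> y\<close>, \<open>y \<in> K\<close>. For fixed \<open>y\<close> these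
  describe a set \<open>C y\<close> that is closed, convex and, because a lower semicontinuous convex function
  decreases at most linearly while \<open>cosh\<close> grows faster, bounded. Finitely many of the \<open>C y\<close> meet
  (\<open>finite_dual_solution\<close>): otherwise the distances to them would serve as weights of a continuous
  convex combination of the points \<open>y\<close>, which maps the closed convex hull into itself; at a fixed
  point \<open>z\<close> every \<open>y\<close> of positive weight has \<open>f z y + \<phi> y < \<phi> z\<close>, and by convexity so has \<open>z\<close> itself,
  which contradicts \<open>f z z = 0\<close>. All of them meet because almost nearest points of
  the finite intersections to a base point can be chosen to form a Cauchy sequence
  (\<open>closed_geo_convex_Inter_nonempty\<close>).

  \<^emph>\<open>Resolvents are unique and nonspreading.\<close> Let \<open>z \<in> L_f x\<close> and test its defining inequality at
  \<open>(1 - t) z \<oplus> t w\<close>. Differentiating the hyperbolic inequality at \<open>t = 0\<close> gives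
  \<open>D * (cosh D * cosh d(x, z) - cosh d(x, w)) \<le> f z w * sinh D\<close> with \<open>D = d(z, w)\<close>. For \<open>w \<in> L_f y\<close>,
  adding the inequality with the roles exchanged and using monotonicity removes \<open>f\<close> and leaves the
  nonspreading inequality. For \<open>x = y\<close> it forces \<open>z = w\<close>; for \<open>x = z\<close> it says \<open>0 \<le> f z w\<close>,
  so that fixed points are equilibria. Finally Minty's argument with \<open>\<phi> = 0\<close> exhibits the set of
  equilibria as an intersection of closed convex sublevel sets.
\<close>


section \<open>The hyperbolic plane and comparison triangles\<close>

lemma cosh_dist_hyp_plane:
  "cosh (dist u v) = - lorentz (Rep_hyp_plane u) (Rep_hyp_plane v)"
proof -
  have "- lorentz (Rep_hyp_plane u) (Rep_hyp_plane v) \<ge> 1"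
    using lorentz_le(1) Rep_hyp_plane[of u] Rep_hyp_plane[of v] by blast
  then show ?thesis by (simp add: dist_hyp_plane_def)
qed

lemma lorentz_bilinear:
  "lorentz u (a *\<^sub>R v + b *\<^sub>R w) = a * lorentz u v + b * lorentz u w"
  "lorentz (a *\<^sub>R v + b *\<^sub>R w) u = a * lorentz v u + b * lorentz w u"
  by (cases u; cases v; cases w; simp add: algebra_simps)+

lemma lorentz_commute: "lorentz u v = lorentz v u"
  by (cases u; cases v) (simp add: algebra_simps)

text \<open>
  The left side is what bilinearity produces for the Lorentz product of the points with parameters
  \<open>s\<close> and \<open>t\<close> on a hyperbolic segment of length \<open>D\<close>; the identity shows that the
  segment is parametrised by arc length.
\<close>

lemma sinh_interpolation:
  fixes D s t :: real
  shows "sinh (D - s) * sinh (D - t) + sinh s * sinh t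
      + cosh D * (sinh (D - s) * sinh t + sinh s * sinh (D - t)) = (sinh D)\<^sup>2 * cosh (s - t)"
proof -
  have "(cosh D)\<^sup>2 = 1 + (sinh D)\<^sup>2" "(cosh s)\<^sup>2 = 1 + (sinh s)\<^sup>2" "(cosh t)\<^sup>2 = 1 + (sinh t)\<^sup>2"
    by (simp_all add: cosh_square_eq)
  then show ?thesis unfolding sinh_diff cosh_diff by algebra
qed

text \<open>
  With \<open>P\<close> and \<open>Q\<close> the vectors of \<open>p\<close> and \<open>q\<close> and \<open>D\<close> their distance, the geodesic is
  \<open>(sinh (D - s) P + sinh s Q) / sinh D\<close>. Pairing this vector with that of \<open>r\<close> gives the last
  property, Stewart's theorem of hyperbolic geometry.
\<close>

lemma hyp_plane_point_on_side:
  fixes p q :: hyp_plane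
  assumes s: "s \<in> {0..dist p q}"
  obtains w where "w \<in> geo_segment p q" "dist p w = s"
    "\<And>r. sinh (dist p q) * cosh (dist r w)
          = sinh (dist p q - s) * cosh (dist r p) + sinh s * cosh (dist r q)"
proof (cases "p = q")
  case True
  have "geodesic (\<lambda>_. p) p p" by (simp add: geodesic_def)
  then have "p \<in> geo_segment p q" using True by (auto simp: geo_segment_def)
  then show ?thesis using that[of p] True s by simp
next
  case False
  define D where "D = dist p q"
  have D: "D > 0" using False by (simp add: D_def)
  then have sD: "sinh D > 0" by simp
  define P Q where "P = Rep_hyp_plane p" and "Q = Rep_hyp_plane q"
  have P: "lorentz P P = -1" "snd (snd P) > 0" and Q: "lorentz Q Q = -1" "snd (snd Q) > 0"
    using Rep_hyp_plane[of p] Rep_hyp_plane[of q] by (auto simp: P_def Q_def)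
  have PQ: "lorentz P Q = - cosh D" "lorentz Q P = - cosh D"
    using cosh_dist_hyp_plane[of p q] by (simp_all add: P_def Q_def D_def lorentz_commute)
  define W where "W s = (sinh (D - s) / sinh D) *\<^sub>R P + (sinh s / sinh D) *\<^sub>R Q" for s
  have WW: "lorentz (W s) (W t) = - cosh (s - t)" for s t
  proof -
    have "(sinh D)\<^sup>2 * lorentz (W s) (W t) = - (sinh (D - s) * sinh (D - t) + sinh s * sinh t
      + cosh D * (sinh (D - s) * sinh t + sinh s * sinh (D - t)))"
      using sD by (simp add: W_def lorentz_bilinear P Q PQ power2_eq_square field_simps)
    also have "\<dots> = (sinh D)\<^sup>2 * - cosh (s - t)" by (simp add: sinh_interpolation)
    finally show ?thesis using sD by (metis mult_left_cancel zero_less_power less_irrefl)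
  qed
  define c where "c s = Abs_hyp_plane (W s)" for s
  have Rc: "Rep_hyp_plane (c s) = W s" if "s \<in> {0..D}" for s
  proof -
    have "snd (snd (W s)) = (sinh (D - s) * snd (snd P) + sinh s * snd (snd Q)) / sinh D"
      by (simp add: W_def add_divide_distrib)
    moreover have "sinh (D - s) * snd (snd P) + sinh s * snd (snd Q) > 0"
    proof (cases "s = 0")
      case True then show ?thesis using D P by simp
    next
      case False
      then have "sinh s > 0" "sinh (D - s) \<ge> 0" using that by auto
      then show ?thesis using P Q by (simp add: add_nonneg_pos)
    qed
    ultimately have "snd (snd (W s)) > 0" using sD by simp
    then show ?thesis unfolding c_def by (intro Abs_hyp_plane_inverse) (simp add: WW)
  qed
  have dc: "dist (c s) (c t) = \<bar>s - t\<bar>" if "s \<in> {0..D}" "t \<in> {0..D}" for s t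
  proof -
    have "cosh (dist (c s) (c t)) = cosh \<bar>s - t\<bar>"
      by (simp add: cosh_dist_hyp_plane Rc[OF that(1)] Rc[OF that(2)] WW)
    then show ?thesis by (metis abs_ge_zero cosh_real_nonneg_le_iff order_antisym order_refl zero_le_dist)
  qed
  have "W 0 = P" "W D = Q" using sD by (simp_all add: W_def)
  then have c0: "c 0 = p" "c D = q" by (simp_all add: c_def P_def Q_def Rep_hyp_plane_inverse)
  have geo: "geodesic c p q" using dc c0 by (simp add: geodesic_def flip: D_def)
  have s': "s \<in> {0..D}" using s by (simp add: D_def)
  show ?thesis
  proof (rule that[of "c s"])
    show "c s \<in> geo_segment p q" using geo s by (auto simp: geo_segment_def)
    show "dist p (c s) = s" using dc[of 0 s] c0 D s' by auto
    show "sinh (dist p q) * cosh (dist r (c s))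
          = sinh (dist p q - s) * cosh (dist r p) + sinh s * cosh (dist r q)" for r
      using sD by (simp add: cosh_dist_hyp_plane Rc[OF s'] W_def lorentz_bilinear field_simps
          flip: D_def P_def Q_def)
  qed
qed

text \<open>
  The vertex \<open>q'\<close> is put at the apex of the hyperboloid. The hyperbolic law of cosines
  prescribes the cosine \<open>k\<close> of the angle there, and the triangle inequalities say exactly that
  \<open>\<bar>k\<bar> \<le> 1\<close>.
\<close>

lemma comparison_triangle_exists:
  fixes p q r :: "'a::metric_space"
  obtains p' q' r' where "comparison_triangle p q r p' q' r'"
proof -
  define a b c where "a = dist p q" and "b = dist q r" and "c = dist r p"
  have nn: "a \<ge> 0" "b \<ge> 0" "c \<ge> 0" by (simp_all add: a_def b_def c_def)
  have tri: "c \<le> a + b" "\<bar>a - b\<bar> \<le> c"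
    unfolding a_def b_def c_def by (metric+)
  have lo: "cosh (a - b) \<le> cosh c" and hi: "cosh c \<le> cosh (a + b)"
    using tri nn cosh_real_nonneg_le_iff[of "\<bar>a - b\<bar>" c] cosh_real_nonneg_le_iff[of c "a + b"]
    by auto
  have "\<exists>k. \<bar>k\<bar> \<le> 1 \<and> cosh c = cosh a * cosh b - sinh a * sinh b * k"
  \<comment> \<open>If a side at the apex vanishes, any angle will do.\<close>
  proof (cases "sinh a * sinh b = 0")
    case True
    then have "a = 0 \<or> b = 0" by auto
    then have "cosh c = cosh a * cosh b" using lo hi by auto
    then show ?thesis by (intro exI[of _ 0]) simp
  next
    case False
    then have pos: "sinh a * sinh b > 0" using nn by (simp add: less_le)
    define k where "k = (cosh a * cosh b - cosh c) / (sinh a * sinh b)"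
    have "sinh a * sinh b * k = cosh a * cosh b - cosh c" using False by (simp add: k_def)
    moreover have "\<bar>k\<bar> \<le> 1"
      using lo hi pos unfolding k_def by (simp add: abs_le_iff divide_simps cosh_add cosh_diff)
    ultimately show ?thesis by (intro exI[of _ k]) simp
  qed
  then obtain k where k: "\<bar>k\<bar> \<le> 1" "cosh c = cosh a * cosh b - sinh a * sinh b * k" by blast
  have "k\<^sup>2 \<le> 1" using k(1) by (simp add: abs_square_le_1)
  then have m: "(sqrt (1 - k\<^sup>2))\<^sup>2 = 1 - k\<^sup>2" by simp
  define m where "m = sqrt (1 - k\<^sup>2)"
  have m: "m * m = 1 - k * k" using m by (simp add: m_def power2_eq_square)
  define P where "P = (sinh a, 0::real, cosh a)"
  define Q where "Q = (0::real, 0::real, 1::real)"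
  define R where "R = (sinh b * k, sinh b * m, cosh b)"
  have ca: "cosh a * cosh a = 1 + sinh a * sinh a" and cb: "cosh b * cosh b = 1 + sinh b * sinh b"
    using cosh_square_eq[of a] cosh_square_eq[of b] by (simp_all add: power2_eq_square)
  have "lorentz P P = -1" "lorentz Q Q = -1" using ca by (simp_all add: P_def Q_def)
  moreover have "lorentz R R = -1"
  proof -
    have "lorentz R R = sinh b * sinh b * (k * k + m * m) - cosh b * cosh b"
      by (simp add: R_def algebra_simps)
    then show ?thesis using m cb by simp
  qed
  ultimately have rep: "Rep_hyp_plane (Abs_hyp_plane P) = P" "Rep_hyp_plane (Abs_hyp_plane Q) = Q"
    "Rep_hyp_plane (Abs_hyp_plane R) = R"
    by (auto intro!: Abs_hyp_plane_inverse simp: P_def Q_def R_def)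
  have cd: "dist u v = d" if "d \<ge> 0" "cosh (dist u v) = cosh d" for u v :: hyp_plane and d
    using that by (metis cosh_real_nonneg_le_iff order_antisym order_refl zero_le_dist)
  have "comparison_triangle p q r (Abs_hyp_plane P) (Abs_hyp_plane Q) (Abs_hyp_plane R)"
    unfolding comparison_triangle_def a_def[symmetric] b_def[symmetric] c_def[symmetric]
    by (intro conjI cd nn) (simp_all add: cosh_dist_hyp_plane rep, simp_all add: P_def Q_def R_def k(2))
  then show ?thesis by (rule that)
qed

section \<open>The hyperbolic inequality and its consequences\<close>

text \<open>
  Uniqueness of geodesics makes the description in \<open>geo_comb\<close> definite: a point of the
  segment is determined by its distance from \<open>x\<close>.
\<close>

lemma geo_comb_characterization:
  fixes x y :: "'a::metric_space"
  assumes "uniquely_geodesic TYPE('a)" and t: "t \<in> {0..1}"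
  shows "geo_comb t x y \<in> geo_segment x y"
    and "dist x (geo_comb t x y) = (1 - t) * dist x y"
    and "dist (geo_comb t x y) y = t * dist x y"
proof -
  obtain c where c: "geodesic c x y" using assms(1) unfolding uniquely_geodesic_def by blast
  define s where "s = (1 - t) * dist x y"
  have s: "s \<in> {0..dist x y}" using t by (auto simp: s_def mult_left_le_one_le)
  let ?P = "\<lambda>z. z \<in> geo_segment x y \<and> dist x z = (1 - t) * dist x y \<and> dist y z = t * dist x y"
  have "?P (c s)"
  proof (intro conjI)
    show "c s \<in> geo_segment x y" using c s by (auto simp: geo_segment_def)
    have e: "c 0 = x" "c (dist x y) = y" using c unfolding geodesic_def by blast+
    have d: "dist (c s) (c t) = \<bar>s - t\<bar>" if "s \<in> {0..dist x y}" "t \<in> {0..dist x y}" for s t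
      using c that unfolding geodesic_def by blast
    show "dist x (c s) = (1 - t) * dist x y"
      using d[of 0 s] s unfolding e by (simp add: s_def)
    have "dist y (c s) = \<bar>dist x y - s\<bar>"
      using d[of "dist x y" s] s unfolding e by simp
    then show "dist y (c s) = t * dist x y"
      using s by (simp add: s_def algebra_simps)
  qed
  moreover have "z = c s" if z: "?P z" for z
  proof -
    obtain c' s' where c': "geodesic c' x y" "z = c' s'" "s' \<in> {0..dist x y}"
      using z unfolding geo_segment_def by blast
    have "s' = s" using z c' by (auto simp: geodesic_def s_def)
    then show ?thesis using assms(1) c c' by (auto simp: uniquely_geodesic_def)
  qed
  ultimately have "?P (geo_comb t x y)" unfolding geo_comb_def by (rule theI)
  then show "geo_comb t x y \<in> geo_segment x y"
    and "dist x (geo_comb t x y) = (1 - t) * dist x y"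
    and "dist (geo_comb t x y) y = t * dist x y" by (auto simp: dist_commute)
qed

text \<open>
  Stewart's theorem holds with equality for the comparison triangle of \<open>x\<close>, \<open>y\<close>, \<open>p\<close>, and passing from
  there to the space can only shorten the distance from the vertex \<open>p\<close> to the point on the opposite
  side.
\<close>

lemma CAT_minus1_cosh_inequality:
  fixes p x y :: "'a::metric_space"
  assumes cat: "CAT_minus1 TYPE('a)" and t: "t \<in> {0..1}"
  defines "D \<equiv> dist x y"
  shows "sinh D * cosh (dist p (geo_comb t x y))
    \<le> sinh (t * D) * cosh (dist p x) + sinh ((1 - t) * D) * cosh (dist p y)"
proof -
  have ug: "uniquely_geodesic TYPE('a)" using cat by (simp add: CAT_minus1_def)
  note comb = geo_comb_characterization[OF ug t, of x y]
  obtain x' y' p' where ct: "comparison_triangle x y p x' y' p'"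
    by (rule comparison_triangle_exists)
  then have D': "dist x' y' = D" and px: "dist p' x' = dist p x" and py: "dist p' y' = dist p y"
    by (auto simp: comparison_triangle_def D_def dist_commute)
  have "(1 - t) * D \<in> {0..dist x' y'}"
    using t D' by (auto simp: mult_left_le_one_le D_def)
  then obtain w where w: "w \<in> geo_segment x' y'" "dist x' w = (1 - t) * D"
    and eq: "\<And>r. sinh D * cosh (dist r w)
          = sinh (D - (1 - t) * D) * cosh (dist r x') + sinh ((1 - t) * D) * cosh (dist r y')"
    using hyp_plane_point_on_side[of "(1 - t) * D" x' y'] unfolding D' by blast
  have "comparison_on_side x y x' y' (geo_comb t x y) w"
    using w comb by (simp add: comparison_on_side_def D_def)
  \<comment> \<open>The vertex itself counts as a comparison point, being an endpoint of a side.\<close>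
  moreover have "comparison_on_side p x p' x' p p'"
  proof -
    have "p \<in> geo_segment p x"
      using ug unfolding uniquely_geodesic_def geo_segment_def geodesic_def
      by (force simp: image_iff)
    moreover obtain v where "v \<in> geo_segment p' x'" "dist p' v = 0"
      using hyp_plane_point_on_side[of 0 p' x'] by auto
    ultimately show ?thesis by (simp add: comparison_on_side_def)
  qed
  ultimately have "dist p (geo_comb t x y) \<le> dist p' w"
    using cat ct unfolding CAT_minus1_def comparison_point_def by blast
  then have "sinh D * cosh (dist p (geo_comb t x y)) \<le> sinh D * cosh (dist p' w)"
    by (intro mult_left_mono) (auto simp: cosh_real_nonneg_le_iff D_def)
  also have "D - (1 - t) * D = t * D" by (simp add: algebra_simps)
  then have "sinh D * cosh (dist p' w)
    = sinh (t * D) * cosh (dist p x) + sinh ((1 - t) * D) * cosh (dist p y)"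
    using eq[of p'] by (simp add: px py)
  finally show ?thesis .
qed

lemma sinh_le_convex:
  fixes t D :: real
  assumes "t \<in> {0..1}" "D \<ge> 0"
  shows "sinh (t * D) \<le> t * sinh D"
proof -
  have "convex_on {0::real..} sinh"
    by (rule f''_ge0_imp_convex[where f' = cosh and f'' = sinh])
      (auto intro!: derivative_eq_intros)
  from convex_onD[OF this, of t 0 D] show ?thesis using assms by simp
qed

text \<open>
  A point that is nearly at the right distances from both endpoints is near the point of
  the segment: the hyperbolic inequality, read from the moving point, bounds \<open>cosh\<close> of its distance
  to the segment point by a quantity that tends to \<open>sinh D / sinh D = 1\<close>.
\<close>

lemma geo_comb_tendsto:
  fixes x y :: "'a::metric_space"
  assumes cat: "CAT_minus1 TYPE('a)" and t: "t \<in> {0..1}"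
    and x: "((\<lambda>i. dist (m i) x) \<longlongrightarrow> (1 - t) * dist x y) F"
    and y: "((\<lambda>i. dist (m i) y) \<longlongrightarrow> t * dist x y) F"
  shows "(m \<longlongrightarrow> geo_comb t x y) F"
proof (cases "x = y")
  case True
  have "uniquely_geodesic TYPE('a)" using cat by (simp add: CAT_minus1_def)
  from geo_comb_characterization(2)[OF this t, of x y] have "geo_comb t x y = x"
    using True by simp
  then show ?thesis using x True by (subst tendsto_dist_iff) simp
next
  case False
  define D where "D = dist x y"
  have D: "D > 0" using False by (simp add: D_def)
  then have sD: "sinh D > 0" by simp
  define G where "G i = (sinh (t * D) * cosh (dist (m i) x)
      + sinh ((1 - t) * D) * cosh (dist (m i) y)) / sinh D" for i
  have "(G \<longlongrightarrow> (sinh (t * D) * cosh ((1 - t) * D) + sinh ((1 - t) * D) * cosh (t * D)) / sinh D) F"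
    unfolding G_def using x y sD by (intro tendsto_intros) (auto simp: D_def)
  also have "sinh (t * D) * cosh ((1 - t) * D) + sinh ((1 - t) * D) * cosh (t * D) = sinh D"
    using sinh_add[of "t * D" "(1 - t) * D"] by (simp add: algebra_simps)
  finally have "(G \<longlongrightarrow> 1) F" using sD by simp
  then have "((\<lambda>i. cosh (dist (m i) (geo_comb t x y))) \<longlongrightarrow> 1) F"
  proof (rule tendsto_sandwich[rotated -1])
    show "\<forall>\<^sub>F i in F. cosh (dist (m i) (geo_comb t x y)) \<le> G i"
      using CAT_minus1_cosh_inequality[OF cat t, of x y] sD
      by (intro always_eventually allI) (simp add: G_def D_def field_simps)
  qed (auto simp: cosh_real_ge_1)
  then have "((\<lambda>i. arcosh (cosh (dist (m i) (geo_comb t x y)))) \<longlongrightarrow> arcosh 1) F"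
    by (rule tendsto_arcosh_strong) (auto simp: cosh_real_ge_1)
  then show ?thesis by (subst tendsto_dist_iff) (simp add: arcosh_cosh_real)
qed

lemma tendsto_geo_comb:
  fixes x y :: "'a::metric_space"
  assumes cat: "CAT_minus1 TYPE('a)" and u: "(u \<longlongrightarrow> x) F"
    and s: "(s \<longlongrightarrow> t) F" and t: "t \<in> {0..1}" and s01: "\<forall>\<^sub>F i in F. s i \<in> {0..1}"
  shows "((\<lambda>i. geo_comb (s i) (u i) y) \<longlongrightarrow> geo_comb t x y) F"
proof (rule geo_comb_tendsto[OF cat t])
  have ug: "uniquely_geodesic TYPE('a)" using cat by (simp add: CAT_minus1_def)
  have uy: "((\<lambda>i. dist (u i) y) \<longlongrightarrow> dist x y) F" by (intro tendsto_intros u)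
  have ux: "((\<lambda>i. dist (u i) x) \<longlongrightarrow> 0) F" using u by (rule tendsto_dist_iff[THEN iffD1])
  have *: "((\<lambda>i. s i * dist (u i) y) \<longlongrightarrow> t * dist x y) F"
    "((\<lambda>i. (1 - s i) * dist (u i) y) \<longlongrightarrow> (1 - t) * dist x y) F"
    by (intro tendsto_intros s uy)+
  show "((\<lambda>i. dist (geo_comb (s i) (u i) y) y) \<longlongrightarrow> t * dist x y) F"
    using *(1) by (rule Lim_transform_eventually)
      (use s01 in eventually_elim, simp add: geo_comb_characterization[OF ug])
  have "\<bar>dist (geo_comb (s i) (u i) y) x - (1 - s i) * dist (u i) y\<bar> \<le> dist (u i) x"
    if "s i \<in> {0..1}" for i
    using geo_comb_characterization(2)[OF ug that, of "u i" y]
      dist_triangle[of "geo_comb (s i) (u i) y" x "u i"]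
      dist_triangle[of "u i" "geo_comb (s i) (u i) y" x]
    by (simp add: dist_commute)
  then have "((\<lambda>i. dist (geo_comb (s i) (u i) y) x - (1 - s i) * dist (u i) y) \<longlongrightarrow> 0) F"
    by (intro Lim_null_comparison[OF _ ux] eventually_mono[OF s01]) simp
  from tendsto_add[OF this *(2)]
  show "((\<lambda>i. dist (geo_comb (s i) (u i) y) x) \<longlongrightarrow> (1 - t) * dist x y) F" by simp
qed

text \<open>
  Since \<open>sinh\<close> is convex on the half-line and vanishes at \<open>0\<close>, the hyperbolic weights are at most the
  affine ones.
\<close>

lemma CAT_minus1_cosh_convex:
  fixes p x y :: "'a::metric_space"
  assumes cat: "CAT_minus1 TYPE('a)" and t: "t \<in> {0..1}"
  shows "cosh (dist p (geo_comb t x y)) \<le> t * cosh (dist p x) + (1 - t) * cosh (dist p y)"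
proof (cases "x = y")
  case True
  have "uniquely_geodesic TYPE('a)" using cat by (simp add: CAT_minus1_def)
  from geo_comb_characterization(2)[OF this t, of x y] have "geo_comb t x y = x"
    using True by simp
  then show ?thesis using True by (simp add: algebra_simps)
next
  case False
  define D where "D = dist x y"
  have D: "D > 0" using False by (simp add: D_def)
  have "sinh D * cosh (dist p (geo_comb t x y))
    \<le> sinh (t * D) * cosh (dist p x) + sinh ((1 - t) * D) * cosh (dist p y)"
    unfolding D_def by (rule CAT_minus1_cosh_inequality[OF cat t])
  also have "\<dots> \<le> (t * sinh D) * cosh (dist p x) + ((1 - t) * sinh D) * cosh (dist p y)"
    using t D sinh_le_convex[of t D] sinh_le_convex[of "1 - t" D]
    by (intro add_mono mult_right_mono) auto
  also have "\<dots> = sinh D * (t * cosh (dist p x) + (1 - t) * cosh (dist p y))"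
    by (simp add: algebra_simps)
  finally show ?thesis using D by simp
qed

text \<open>
  At the midpoint \<open>sinh D = 2 sinh (D / 2) cosh (D / 2)\<close>, and the extra factor \<open>cosh (D / 2)\<close> that the
  affine estimate loses makes \<open>cosh d(p, \<cdot>)\<close> uniformly convex.
\<close>

lemma CAT_minus1_cosh_midpoint:
  fixes p x y :: "'a::metric_space"
  assumes cat: "CAT_minus1 TYPE('a)"
  shows "2 * cosh (dist x y / 2) * cosh (dist p (geo_comb (1/2) x y))
           \<le> cosh (dist p x) + cosh (dist p y)"
proof (cases "x = y")
  case True
  then show ?thesis using CAT_minus1_cosh_convex[OF cat, of "1/2" p x y] by simp
next
  case False
  define h where "h = dist x y / 2"
  have h: "sinh h > 0" "dist x y = 2 * h" using False by (simp_all add: h_def)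
  from CAT_minus1_cosh_inequality[OF cat, of "1/2" x y p]
  have "sinh h * (2 * cosh h * cosh (dist p (geo_comb (1/2) x y)))
      \<le> sinh h * (cosh (dist p x) + cosh (dist p y))"
    using sinh_double[of h] by (simp add: h(2) algebra_simps)
  then show ?thesis using h by simp
qed

lemma geo_convex_cball:
  fixes p :: "'a::metric_space"
  assumes "CAT_minus1 TYPE('a)"
  shows "geo_convex (cball p R)"
  unfolding geo_convex_def
proof (intro ballI)
  fix x y t assume xy: "x \<in> cball p R" "y \<in> cball p R" and t: "t \<in> {0..1::real}"
  have R: "R \<ge> 0" using xy(1) by (meson mem_cball order_trans zero_le_dist)
  have c: "cosh (dist p x) \<le> cosh R" "cosh (dist p y) \<le> cosh R"
    using xy R by (auto simp: cosh_real_nonneg_le_iff)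
  have "cosh (dist p (geo_comb t x y)) \<le> t * cosh (dist p x) + (1 - t) * cosh (dist p y)"
    by (rule CAT_minus1_cosh_convex[OF assms t])
  also have "\<dots> \<le> t * cosh R + (1 - t) * cosh R"
    using c t by (intro add_mono mult_left_mono) auto
  finally have "cosh (dist p (geo_comb t x y)) \<le> cosh R" by (simp add: algebra_simps)
  then show "geo_comb t x y \<in> cball p R" using R by (simp add: cosh_real_nonneg_le_iff)
qed

text \<open>
  A substitute for \<open>(\<Sum>e. l e z *\<^sub>R e) / (\<Sum>e. l e z)\<close>, which is built by adding the points one
  at a time: the combination of the previous points is joined to the new point in the ratio of
  the weights. Points of weight zero do not influence the result, which is why it lies in every
  convex set that contains the points of positive weight.

  The combination is undefined where all previous weights vanish, and it may be discontinuous
  when that place is approached. If the new weight is positive there, the next combination is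
  continuous nevertheless, since the previous one stays in a ball and enters with a weight that
  tends to zero.
\<close>

lemma continuous_convex_combination:
  fixes E :: "'a::metric_space set" and l :: "'a \<Rightarrow> 'b::t2_space \<Rightarrow> real"
  assumes cat: "CAT_minus1 TYPE('a)" and "finite E"
    and "\<And>e. e \<in> E \<Longrightarrow> continuous_on UNIV (l e)" and "\<And>e z. e \<in> E \<Longrightarrow> l e z \<ge> 0"
  shows "\<exists>h. continuous_on {z. (\<Sum>e\<in>E. l e z) > 0} h \<and>
    (\<forall>z A. (\<Sum>e\<in>E. l e z) > 0 \<longrightarrow> geo_convex A \<longrightarrow> {e\<in>E. l e z > 0} \<subseteq> A \<longrightarrow> h z \<in> A)"
  using assms(2-)
proof (induction E rule: finite_induct)
  case empty
  then show ?case by simp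
next
  case (insert e E)
  have ug: "uniquely_geodesic TYPE('a)" using cat by (simp add: CAT_minus1_def)
  define s where "s z = (\<Sum>e\<in>E. l e z)" for z
  have "\<exists>h. continuous_on {z. s z > 0} h \<and>
    (\<forall>z A. s z > 0 \<longrightarrow> geo_convex A \<longrightarrow> {e\<in>E. l e z > 0} \<subseteq> A \<longrightarrow> h z \<in> A)"
    unfolding s_def by (rule insert.IH) (auto intro: insert.prems)
  then obtain h where h: "continuous_on {z. s z > 0} h"
    and hull: "\<And>z A. s z > 0 \<Longrightarrow> geo_convex A \<Longrightarrow> {e\<in>E. l e z > 0} \<subseteq> A \<Longrightarrow> h z \<in> A"
    by blast
  have s0: "s z \<ge> 0" for z unfolding s_def by (intro sum_nonneg) (auto intro: insert.prems)
  have e0: "l e z \<ge> 0" for z by (rule insert.prems) simp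
  have cs: "continuous_on UNIV s" unfolding s_def
    by (intro continuous_intros) (auto intro: insert.prems)
  have ce: "continuous_on UNIV (l e)" by (rule insert.prems) simp
  define t where "t z = s z / (l e z + s z)" for z
  define k where "k z = (if s z > 0 then geo_comb (t z) (h z) e else e)" for z
  have t01: "t z \<in> {0..1}" for z
    using s0[of z] e0[of z] by (auto simp: t_def divide_simps)
  have ct: "isCont t z" if "l e z + s z > 0" for z
    unfolding t_def using that cs ce
    by (intro continuous_intros) (auto simp: continuous_on_eq_continuous_at)
  obtain R where R: "R \<ge> 0" "E \<subseteq> cball e R"
    using bounded_subset_ballD[OF finite_imp_bounded[OF insert(1)], of e]
    by (meson ball_subset_cball less_imp_le order_trans)
  \<comment> \<open>Balls are convex, so the combination of the previous points cannot escape from one that contains them.\<close>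
  have bnd: "dist (h z) e \<le> R" if "s z > 0" for z
    using hull[OF that geo_convex_cball[OF cat, of e R]] R by (auto simp: dist_commute)
  have "isCont k z" if pos: "l e z + s z > 0" for z
  proof (cases "s z > 0")
    case True
    have op: "open {z. s z > 0}" using cs by (intro open_Collect_less) auto
    then have hz: "isCont h z" using h True by (simp add: continuous_on_eq_continuous_at)
    have "((\<lambda>w. geo_comb (t w) (h w) e) \<longlongrightarrow> geo_comb (t z) (h z) e) (at z)"
      using hz ct[OF pos] t01 by (intro tendsto_geo_comb[OF cat]) (auto simp: isCont_def)
    moreover have "\<forall>\<^sub>F w in at z. geo_comb (t w) (h w) e = k w"
      using eventually_at_topological[of "\<lambda>w. s w > 0" z] op True
      by (auto simp: eventually_at_topological k_def)
    ultimately show ?thesis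
      unfolding isCont_def using True by (auto intro: Lim_transform_eventually simp: k_def)
  next
    case False
    then have "t z = 0" using s0[of z] by (simp add: t_def)
    then have tR: "((\<lambda>w. t w * R) \<longlongrightarrow> 0) (at z)"
      using tendsto_mult_left_zero[of t "at z" R] ct[OF pos] by (simp add: isCont_def)
    have "dist (k w) e \<le> t w * R" for w
    proof (cases "s w > 0")
      case True
      then have "dist (k w) e = t w * dist (h w) e"
        using geo_comb_characterization(3)[OF ug t01[of w], of "h w" e] by (simp add: k_def)
      then show ?thesis using bnd[OF True] t01[of w] by (simp add: mult_left_mono)
    qed (use t01[of w] R in \<open>simp add: k_def\<close>)
    then have "((\<lambda>w. dist (k w) e) \<longlongrightarrow> 0) (at z)"
      by (intro Lim_null_comparison[OF _ tR]) simp
    then have "(k \<longlongrightarrow> e) (at z)" by (rule tendsto_dist_iff[THEN iffD2])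
    then show ?thesis using False by (simp add: isCont_def k_def[of z])
  qed
  then have "continuous_on {z. l e z + s z > 0} k"
    by (auto intro!: continuous_at_imp_continuous_on)
  moreover have "k z \<in> A"
    if pos: "l e z + s z > 0" and A: "geo_convex A" "{e'\<in>insert e E. l e' z > 0} \<subseteq> A" for z A
  proof (cases "s z > 0")
    case True
    then have hz: "h z \<in> A" using A by (intro hull) auto
    show ?thesis
    proof (cases "l e z > 0")
      case True
      then have "e \<in> A" using A by auto
      then show ?thesis using hz A t01[of z] \<open>s z > 0\<close> by (auto simp: geo_convex_def k_def)
    next
      case False
      then have "t z = 1" using e0[of z] \<open>s z > 0\<close> by (simp add: t_def)
      then have "k z = h z"
        using geo_comb_characterization(2)[OF ug t01[of z], of "h z" e] \<open>s z > 0\<close>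
        by (simp add: k_def)
      then show ?thesis using hz by simp
    qed
  next
    case False
    then show ?thesis using pos s0[of z] A(2) by (auto simp: k_def)
  qed
  ultimately show ?case using insert(1,2) by (intro exI[of _ k]) (auto simp: s_def)
qed

section \<open>Convex functions and convex hulls\<close>

lemma geo_comb_endpoints:
  fixes x y :: "'a::metric_space"
  assumes "uniquely_geodesic TYPE('a)"
  shows "geo_comb 1 x y = x" and "geo_comb 0 x y = y"
  using geo_comb_characterization(2)[OF assms, of 1 x y]
    geo_comb_characterization(3)[OF assms, of 0 x y] by simp_all

text \<open>
  The endpoints \<open>t = 0\<close> and \<open>t = 1\<close> are missing from \<open>geo_convex_on\<close>, but at them the inequality is an
  equality.
\<close>

lemma geo_convex_on_le:
  fixes K :: "'a::metric_space set"
  assumes "uniquely_geodesic TYPE('a)" "geo_convex_on K g" "x \<in> K" "y \<in> K" "t \<in> {0..1}"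
  shows "g (geo_comb t x y) \<le> t * g x + (1 - t) * g y"
proof (cases "t = 0 \<or> t = 1")
  case True
  then show ?thesis using geo_comb_endpoints[OF assms(1), of x y] by auto
next
  case False
  then have "t \<in> {0<..<1}" using assms(5) by auto
  then show ?thesis using assms(2-4) by (auto simp: geo_convex_on_def)
qed

lemma geo_convex_on_add:
  assumes "geo_convex_on K g" "geo_convex_on K h"
  shows "geo_convex_on K (\<lambda>x. g x + h x)"
  unfolding geo_convex_on_def
proof (intro ballI)
  fix x y \<alpha> assume "x \<in> K" "y \<in> K" "\<alpha> \<in> {0<..<1::real}"
  then have "g (geo_comb \<alpha> x y) \<le> \<alpha> * g x + (1 - \<alpha>) * g y"
    "h (geo_comb \<alpha> x y) \<le> \<alpha> * h x + (1 - \<alpha>) * h y"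
    using assms unfolding geo_convex_on_def by blast+
  then show "g (geo_comb \<alpha> x y) + h (geo_comb \<alpha> x y)
      \<le> \<alpha> * (g x + h x) + (1 - \<alpha>) * (g y + h y)"
    by (simp add: algebra_simps)
qed

lemma geo_convex_sublevel:
  fixes K :: "'a::metric_space set"
  assumes ug: "uniquely_geodesic TYPE('a)" and K: "geo_convex K" and g: "geo_convex_on K g"
  shows "geo_convex {x \<in> K. g x \<le> a}" and "geo_convex {x \<in> K. g x < a}"
proof -
  show "geo_convex {x \<in> K. g x \<le> a}"
    unfolding geo_convex_def
  proof (intro ballI)
    fix x y t assume x: "x \<in> {x \<in> K. g x \<le> a}" and y: "y \<in> {x \<in> K. g x \<le> a}" and t: "t \<in> {0..1::real}"
    have "g (geo_comb t x y) \<le> t * g x + (1 - t) * g y"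
      using x y t by (intro geo_convex_on_le[OF ug g]) auto
    also have "\<dots> \<le> a" using x y t by (intro convex_bound_le) auto
    finally show "geo_comb t x y \<in> {x \<in> K. g x \<le> a}"
      using K x y t by (auto simp: geo_convex_def)
  qed
  show "geo_convex {x \<in> K. g x < a}"
    unfolding geo_convex_def
  proof (intro ballI)
    fix x y t assume x: "x \<in> {x \<in> K. g x < a}" and y: "y \<in> {x \<in> K. g x < a}" and t: "t \<in> {0..1::real}"
    have "g (geo_comb t x y) \<le> t * g x + (1 - t) * g y"
      using x y t by (intro geo_convex_on_le[OF ug g]) auto
    also have "\<dots> < a" using x y t by (intro convex_bound_lt) auto
    finally show "geo_comb t x y \<in> {x \<in> K. g x < a}"
      using K x y t by (auto simp: geo_convex_def)
  qed
qed

lemma geo_convex_Inter: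
  assumes "\<And>C. C \<in> \<C> \<Longrightarrow> geo_convex C"
  shows "geo_convex (\<Inter>\<C>)"
  using assms unfolding geo_convex_def by blast

lemma geo_hull_superset: "E \<subseteq> geo_hull E"
  unfolding geo_hull_def by (rule UN_upper[of 0 UNIV "hull_stage E", simplified])

lemma geo_hull_minimal:
  assumes "E \<subseteq> K" "geo_convex K"
  shows "geo_hull E \<subseteq> K"
proof -
  have "hull_stage E n \<subseteq> K" for n
  proof (induction n)
    case (Suc n)
    then show ?case using assms(2) unfolding geo_convex_def by fastforce
  qed (use assms in simp)
  then show ?thesis by (auto simp: geo_hull_def)
qed

lemma geo_convex_geo_hull:
  fixes E :: "'a::metric_space set"
  assumes ug: "uniquely_geodesic TYPE('a)"
  shows "geo_convex (geo_hull E)"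
  unfolding geo_convex_def
proof (intro ballI)
  fix x y t assume "x \<in> geo_hull E" "y \<in> geo_hull E" and t: "t \<in> {0..1::real}"
  then obtain m n where mn: "x \<in> hull_stage E m" "y \<in> hull_stage E n" by (auto simp: geo_hull_def)
  have "hull_stage E k \<subseteq> hull_stage E (Suc k)" for k
  proof
    fix u assume u: "u \<in> hull_stage E k"
    have "u = geo_comb 1 u u" by (simp add: geo_comb_endpoints[OF ug])
    then show "u \<in> hull_stage E (Suc k)" using u by fastforce
  qed
  then have "mono (hull_stage E)" by (rule mono_iff_le_Suc[THEN iffD2, rule_format])
  then have "hull_stage E m \<subseteq> hull_stage E (max m n)" "hull_stage E n \<subseteq> hull_stage E (max m n)"
    by (simp_all add: monoD)
  then have "x \<in> hull_stage E (max m n)" "y \<in> hull_stage E (max m n)"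
    using mn by auto
  then have "geo_comb t x y \<in> hull_stage E (Suc (max m n))" using t by auto
  then show "geo_comb t x y \<in> geo_hull E" unfolding geo_hull_def by blast
qed

lemma cosh_ge_quadratic: "1 + x\<^sup>2 / 2 \<le> cosh (x::real)"
proof -
  have "\<bar>x / 2\<bar> \<le> \<bar>sinh (x / 2)\<bar>"
    using real_le_abs_sinh[of "x / 2"] by (simp add: sinh_field_def exp_minus)
  then have "(x / 2)\<^sup>2 \<le> (sinh (x / 2))\<^sup>2" by (rule abs_le_square_iff[THEN iffD1])
  moreover have "cosh x = 1 + 2 * (sinh (x / 2))\<^sup>2"
    using cosh_double_cosh[of "x / 2"] by (simp add: cosh_square_eq)
  ultimately show ?thesis by (simp add: power2_eq_square)
qed

section \<open>Intersections of closed convex sets\<close>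

text \<open>
  Let \<open>m \<F>\<close> be the infimum of \<open>cosh d(p, \<cdot>)\<close> over the finite intersection \<open>\<Inter>\<F>\<close>. It grows with \<open>\<F>\<close>, and the
  bounded set \<open>C0\<close> keeps it below a supremum \<open>S\<close>. Two almost minimal points of \<open>\<Inter>\<F>\<close> with \<open>m \<F>\<close> close
  to \<open>S\<close> must be close to each other, since their midpoint is in \<open>\<Inter>\<F>\<close> too and uniform convexity would
  otherwise push its value below \<open>m \<F>\<close>. Hence almost minimal points along an increasing sequence of
  finite subfamilies are Cauchy. Adjoining one more set \<open>C\<close> changes these points by arbitrarily
  little, so their limit lies in \<open>C\<close>.
\<close>

lemma closed_geo_convex_Inter_nonempty:
  fixes \<C> :: "'a::complete_space set set"
  assumes cat: "CAT_minus1 TYPE('a)"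
    and fip: "\<And>\<F>. finite \<F> \<Longrightarrow> \<F> \<subseteq> \<C> \<Longrightarrow> \<Inter>\<F> \<noteq> {}"
    and cl: "\<And>C. C \<in> \<C> \<Longrightarrow> closed C" and cv: "\<And>C. C \<in> \<C> \<Longrightarrow> geo_convex C"
    and C0: "C0 \<in> \<C>" "bounded C0"
  shows "\<Inter>\<C> \<noteq> {}"
proof -
  \<comment> \<open>The base point is arbitrary.\<close>
  obtain p :: 'a where True by simp
  define \<phi> where "\<phi> q = cosh (dist p q)" for q
  obtain B where B: "C0 \<subseteq> ball p B" using bounded_subset_ballD[OF C0(2)] by blast
  define Fam where "Fam = {\<F>. finite \<F> \<and> \<F> \<subseteq> \<C> \<and> C0 \<in> \<F>}"
  have Fam0: "{C0} \<in> Fam" using C0 by (simp add: Fam_def)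
  define m where "m \<F> = (INF q\<in>\<Inter>\<F>. \<phi> q)" for \<F>
  have ne: "\<Inter>\<F> \<noteq> {}" if "\<F> \<in> Fam" for \<F> using fip that by (auto simp: Fam_def)
  have \<phi>_bdd: "bdd_below (\<phi> ` A)" for A
    by (auto simp: \<phi>_def intro!: bdd_belowI[of _ 1] cosh_real_ge_1)
  have m_le: "m \<F> \<le> \<phi> q" if "q \<in> \<Inter>\<F>" for \<F> q
    unfolding m_def by (rule cINF_lower[OF \<phi>_bdd that])
  have m_ge: "1 \<le> m \<F>" if "\<F> \<in> Fam" for \<F>
    unfolding m_def using ne[OF that] by (intro cINF_greatest) (auto simp: \<phi>_def cosh_real_ge_1)
  have m_bdd: "m \<F> \<le> cosh B" if \<F>: "\<F> \<in> Fam" for \<F>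
  proof -
    obtain q where q: "q \<in> \<Inter>\<F>" using ne[OF \<F>] by blast
    then have "q \<in> ball p B" using \<F> B by (auto simp: Fam_def)
    then have "0 \<le> B" "dist p q \<le> B" using zero_le_dist[of p q] by (auto simp del: zero_le_dist)
    then have "\<phi> q \<le> cosh B" by (simp add: \<phi>_def cosh_real_nonneg_le_iff)
    then show ?thesis using m_le[OF q] by linarith
  qed
  define S where "S = (SUP \<F>\<in>Fam. m \<F>)"
  have bdd: "bdd_above (m ` Fam)" using m_bdd by (auto intro!: bdd_aboveI[of _ "cosh B"])
  have m_S: "m \<F> \<le> S" if "\<F> \<in> Fam" for \<F>
    unfolding S_def using that bdd by (rule cSUP_upper)
  have S1: "1 \<le> S" using m_ge[OF Fam0] m_S[OF Fam0] by linarith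
  have near: "\<exists>\<F>\<in>Fam. S - \<epsilon> < m \<F>" if "\<epsilon> > 0" for \<epsilon>
  proof -
    have "S - \<epsilon> < (SUP \<F>\<in>Fam. m \<F>)" using that by (simp add: S_def)
    then show ?thesis using Fam0 by (subst (asm) less_cSUP_iff[OF _ bdd]) auto
  qed
  have pick: "\<exists>q\<in>\<Inter>\<F>. \<phi> q < S + \<epsilon>" if "\<F> \<in> Fam" "\<epsilon> > 0" for \<F> \<epsilon>
  proof -
    have "(INF q\<in>\<Inter>\<F>. \<phi> q) < S + \<epsilon>" using m_S[OF that(1)] that(2) by (simp add: m_def)
    then show ?thesis by (subst (asm) cINF_less_iff[OF ne[OF that(1)] \<phi>_bdd])
  qed
  \<comment> \<open>With \<open>cosh (d / 2) \<ge> 1 + d\<^sup>2 / 8\<close> and \<open>S - \<epsilon> \<ge> 1 / 2\<close> the midpoint estimate gives this constant.\<close>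
  have small: "(dist u v)\<^sup>2 \<le> 32 * \<epsilon>"
    if \<F>: "\<F> \<in> Fam" "S - \<epsilon> < m \<F>" and \<epsilon>: "0 < \<epsilon>" "\<epsilon> \<le> 1/2"
      and u: "u \<in> \<Inter>\<F>" "\<phi> u < S + \<epsilon>" and v: "v \<in> \<Inter>\<F>" "\<phi> v < S + \<epsilon>" for \<F> \<epsilon> u v
  proof -
    define w where "w = geo_comb (1/2) u v"
    have "geo_convex (\<Inter>\<F>)" using \<F> cv by (intro geo_convex_Inter) (auto simp: Fam_def)
    then have "w \<in> \<Inter>\<F>" using u v by (auto simp: w_def geo_convex_def)
    then have w: "S - \<epsilon> < \<phi> w" using m_le \<F>(2) by (meson less_le_trans)
    have "2 * ((1 + (dist u v)\<^sup>2 / 8) * (S - \<epsilon>)) \<le> 2 * (cosh (dist u v / 2) * \<phi> w)"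
      using w S1 \<epsilon> cosh_ge_quadratic[of "dist u v / 2"]
      by (intro mult_left_mono mult_mono) (auto simp: power_divide)
    also have "\<dots> \<le> \<phi> u + \<phi> v"
      using CAT_minus1_cosh_midpoint[OF cat, of u v p] by (simp add: w_def \<phi>_def mult.assoc)
    also have "\<dots> \<le> 2 * (S + \<epsilon>)" using u v by simp
    finally have "(dist u v)\<^sup>2 * (S - \<epsilon>) \<le> 16 * \<epsilon>" by (simp add: algebra_simps)
    moreover have "(dist u v)\<^sup>2 * (1/2) \<le> (dist u v)\<^sup>2 * (S - \<epsilon>)"
      using S1 \<epsilon> by (intro mult_left_mono) auto
    ultimately show ?thesis by simp
  qed
  define \<epsilon> where "\<epsilon> n = inverse (real (Suc n)) / 2" for n
  have \<epsilon>: "0 < \<epsilon> n" "\<epsilon> n \<le> 1/2" for n by (simp_all add: \<epsilon>_def field_simps)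
  have \<epsilon>_mono: "\<epsilon> k \<le> \<epsilon> n" if "n \<le> k" for n k using that by (simp add: \<epsilon>_def field_simps)
  have "\<epsilon> \<longlonglongrightarrow> 0 / 2" unfolding \<epsilon>_def by (intro tendsto_intros LIMSEQ_inverse_real_of_nat) simp
  then have lim: "(\<lambda>n. sqrt (32 * \<epsilon> n)) \<longlonglongrightarrow> 0"
    using tendsto_real_sqrt[OF tendsto_mult_right_zero[of \<epsilon> sequentially 32]] by simp
  have "\<forall>n. \<exists>\<F>\<in>Fam. S - \<epsilon> n < m \<F>" using near \<epsilon> by blast
  then obtain G where G: "\<And>n. G n \<in> Fam" "\<And>n. S - \<epsilon> n < m (G n)" by metis
  \<comment> \<open>Unions make the subfamilies increasing, so later points also lie in all earlier intersections.\<close>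
  define H where "H n = (\<Union>k\<le>n. G k)" for n
  have H: "H n \<in> Fam" for n using G(1) by (auto simp: H_def Fam_def)
  have HG: "\<Inter>(H k) \<subseteq> \<Inter>(G n)" if "n \<le> k" for n k using that by (auto simp: H_def)
  have "\<forall>n. \<exists>q\<in>\<Inter>(H n). \<phi> q < S + \<epsilon> n" using pick H \<epsilon> by blast
  then obtain u where u: "\<And>n. u n \<in> \<Inter>(H n)" "\<And>n. \<phi> (u n) < S + \<epsilon> n" by metis
  have near_u: "dist (u n) v \<le> sqrt (32 * \<epsilon> n)" if "v \<in> \<Inter>(G n)" "\<phi> v < S + \<epsilon> n" for n v
    using small[OF G(1) G(2) \<epsilon> _ u(2) that] HG[OF order_refl, of n] u(1)[of n]
    by (intro real_le_rsqrt) blast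
  have "Cauchy u"
    unfolding Cauchy_altdef
  proof (intro allI impI)
    fix e :: real assume "e > 0"
    then have "\<forall>\<^sub>F n in sequentially. sqrt (32 * \<epsilon> n) < e" using lim by (auto dest: order_tendstoD)
    then obtain N where N: "\<And>n. n \<ge> N \<Longrightarrow> sqrt (32 * \<epsilon> n) < e" by (auto simp: eventually_sequentially)
    have "dist (u n) (u k) < e" if "n \<ge> N" "k > n" for n k
    proof -
      have "u k \<in> \<Inter>(G n)" using HG[of n k] u(1)[of k] that(2) by (auto dest: less_imp_le)
      moreover have "\<phi> (u k) < S + \<epsilon> n" using u(2)[of k] \<epsilon>_mono[of n k] that(2) by linarith
      ultimately have "dist (u n) (u k) \<le> sqrt (32 * \<epsilon> n)" by (rule near_u)
      then show ?thesis using N[OF that(1)] by linarith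
    qed
    then show "\<exists>M. \<forall>m\<ge>M. \<forall>n>m. dist (u m) (u n) < e" by blast
  qed
  then obtain x where x: "u \<longlonglongrightarrow> x" by (meson Cauchy_convergent convergent_def)
  have "x \<in> C" if C: "C \<in> \<C>" for C
  proof -
    have "insert C (H n) \<in> Fam" for n using H[of n] C by (auto simp: Fam_def)
    then have "\<forall>n. \<exists>q\<in>\<Inter>(insert C (H n)). \<phi> q < S + \<epsilon> n" using pick \<epsilon> by blast
    then obtain v where v: "\<And>n. v n \<in> \<Inter>(insert C (H n))" "\<And>n. \<phi> (v n) < S + \<epsilon> n" by metis
    have "dist (u n) (v n) \<le> sqrt (32 * \<epsilon> n)" for n
    proof (rule near_u[OF _ v(2)])
      show "v n \<in> \<Inter>(G n)" using v(1)[of n] HG[OF order_refl, of n] by blast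
    qed
    then have "(\<lambda>n. dist (u n) (v n)) \<longlonglongrightarrow> 0"
      by (intro Lim_null_comparison[OF _ lim]) auto
    moreover have "(\<lambda>n. dist (u n) x) \<longlonglongrightarrow> 0" using x by (rule tendsto_dist_iff[THEN iffD1])
    ultimately have "(\<lambda>n. dist (u n) (v n) + dist (u n) x) \<longlonglongrightarrow> 0"
      using tendsto_add by fastforce
    then have "(\<lambda>n. dist (v n) x) \<longlonglongrightarrow> 0"
      by (rule Lim_null_comparison[rotated]) (simp add: dist_triangle3)
    then have "v \<longlonglongrightarrow> x" by (rule tendsto_dist_iff[THEN iffD2])
    then show ?thesis using closed_sequentially[OF cl[OF C], of v x] v by auto
  qed
  then show ?thesis by blast
qed

text \<open>
  Along a convergent sequence \<open>\<phi>\<close> is eventually within \<open>e\<close> of its limit, so the sequence ends up in a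
  closed sublevel set of \<open>g\<close> whose level is off by \<open>e\<close>.
\<close>

lemma closed_sublevel_add_continuous:
  fixes K :: "'a::metric_space set"
  assumes K: "closed K" and g: "lsc_on K g" and \<phi>: "continuous_on K \<phi>"
  shows "closed {z \<in> K. g z + \<phi> z \<le> c}"
  unfolding closed_sequential_limits
proof (intro allI impI, elim conjE)
  fix zs z assume zs: "\<forall>n. zs n \<in> {z \<in> K. g z + \<phi> z \<le> c}" and lim: "zs \<longlonglongrightarrow> z"
  have z: "z \<in> K" using closed_sequentially[OF K _ lim] zs by auto
  have \<phi>lim: "(\<lambda>n. \<phi> (zs n)) \<longlonglongrightarrow> \<phi> z"
    using zs by (intro continuous_on_tendsto_compose[OF \<phi> lim z]) auto
  have "g z \<le> c - \<phi> z + e" if "e > 0" for e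
  proof -
    have "closed {w \<in> K. g w \<le> c - \<phi> z + e}"
      using g K closedin_closed_trans by (auto simp: lsc_on_def)
    moreover have "\<forall>\<^sub>F n in sequentially. zs n \<in> {w \<in> K. g w \<le> c - \<phi> z + e}"
    proof (rule eventually_mono)
      show "\<forall>\<^sub>F n in sequentially. \<phi> z - e < \<phi> (zs n)"
        using that by (intro order_tendstoD(1)[OF \<phi>lim]) simp
      fix n assume "\<phi> z - e < \<phi> (zs n)"
      moreover have "zs n \<in> K" "g (zs n) + \<phi> (zs n) \<le> c" using zs by auto
      ultimately show "zs n \<in> {w \<in> K. g w \<le> c - \<phi> z + e}" by simp
    qed
    ultimately have "z \<in> {w \<in> K. g w \<le> c - \<phi> z + e}"
      using lim by (intro Lim_in_closed_set) auto
    then show ?thesis by simp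
  qed
  then have "g z \<le> c - \<phi> z" by (rule field_le_epsilon)
  then show "z \<in> {z \<in> K. g z + \<phi> z \<le> c}" using z by simp
qed

section \<open>Equilibrium problems and their duals\<close>

locale equilibrium_problem =
  fixes K :: "'a::complete_space set" and f :: "'a \<Rightarrow> 'a \<Rightarrow> real"
  assumes cat: "CAT_minus1 TYPE('a)"
    and closed_K: "closed K" and convex_K: "geo_convex K"
    and diagonal: "x \<in> K \<Longrightarrow> f x x = 0"
    and monotone: "x \<in> K \<Longrightarrow> y \<in> K \<Longrightarrow> f x y + f y x \<le> 0"
    and lsc: "x \<in> K \<Longrightarrow> lsc_on K (f x)"
    and conv: "x \<in> K \<Longrightarrow> geo_convex_on K (f x)"
    and hemicontinuous: "y \<in> K \<Longrightarrow> upper_hemicontinuous_on K (\<lambda>x. f x y)"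
begin

lemma unique_geodesics: "uniquely_geodesic TYPE('a)"
  using cat by (simp add: CAT_minus1_def)

lemmas comb = geo_comb_characterization[OF unique_geodesics]

lemma comb_in_K: "x \<in> K \<Longrightarrow> y \<in> K \<Longrightarrow> t \<in> {0..1} \<Longrightarrow> geo_comb t x y \<in> K"
  using convex_K by (simp add: geo_convex_def)

text \<open>
  One direction is monotonicity. For the other, move from \<open>z\<close> towards \<open>y\<close> to the point \<open>w t\<close>. The
  convex function \<open>f (w t) u + \<phi> u - \<phi> (w t)\<close> of \<open>u\<close> vanishes at \<open>u = w t\<close> and, by the dual inequality, is
  not positive at \<open>u = z\<close>, so it is not negative at \<open>u = y\<close>. Hemicontinuity carries this to the
  limit \<open>t \<rightarrow> 0\<close>.
\<close>

lemma Minty: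
  assumes \<phi>: "continuous_on K \<phi>" "geo_convex_on K \<phi>" and z: "z \<in> K"
  shows "(\<forall>y\<in>K. \<phi> z \<le> f z y + \<phi> y) \<longleftrightarrow> (\<forall>y\<in>K. f y z + \<phi> z \<le> \<phi> y)"
proof
  assume "\<forall>y\<in>K. \<phi> z \<le> f z y + \<phi> y"
  then show "\<forall>y\<in>K. f y z + \<phi> z \<le> \<phi> y" using monotone[OF _ z] by fastforce
next
  assume dual: "\<forall>y\<in>K. f y z + \<phi> z \<le> \<phi> y"
  show "\<forall>y\<in>K. \<phi> z \<le> f z y + \<phi> y"
  proof
    fix y assume y: "y \<in> K"
    define w where "w t = geo_comb (1 - t) z y" for t
    have wK: "w t \<in> K" if "t \<in> {0<..<1}" for t
      using that by (auto simp: w_def intro!: comb_in_K z y)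
    have near0: "\<forall>\<^sub>F t in at_right 0. t \<in> {0<..<1::real}"
      by (rule eventually_at_right_real) simp
    have lower: "\<phi> (w t) - \<phi> y \<le> f (w t) y" if t: "t \<in> {0<..<1}" for t
    proof -
      have "geo_convex_on K (\<lambda>u. f (w t) u + \<phi> u)"
        by (rule geo_convex_on_add[OF conv[OF wK[OF t]] \<phi>(2)])
      then have "f (w t) (w t) + \<phi> (w t)
          \<le> (1 - t) * (f (w t) z + \<phi> z) + (1 - (1 - t)) * (f (w t) y + \<phi> y)"
        unfolding w_def by (rule geo_convex_on_le[OF unique_geodesics _ z y]) (use t in auto)
      also have "\<dots> \<le> (1 - t) * \<phi> (w t) + t * (f (w t) y + \<phi> y)"
        using dual wK[OF t] t by (auto intro!: mult_left_mono)
      finally have "0 \<le> t * (f (w t) y + \<phi> y - \<phi> (w t))"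
        using diagonal[OF wK[OF t]] by (simp add: algebra_simps)
      then show ?thesis using t by (simp add: zero_le_mult_iff)
    qed
    have "((\<lambda>t. dist (w t) z) \<longlongrightarrow> 0) (at_right 0)"
    proof (rule Lim_transform_eventually)
      have "((\<lambda>t. t * dist z y) \<longlongrightarrow> 0 * dist z y) (at_right 0)" by (intro tendsto_intros)
      then show "((\<lambda>t. t * dist z y) \<longlongrightarrow> 0) (at_right 0)" by simp
      show "\<forall>\<^sub>F t in at_right 0. t * dist z y = dist (w t) z"
        using near0 by eventually_elim (use comb(2)[of _ z y] in \<open>auto simp: w_def dist_commute\<close>)
    qed
    then have "(w \<longlongrightarrow> z) (at_right 0)" by (rule tendsto_dist_iff[THEN iffD2])
    then have "((\<lambda>t. \<phi> (w t)) \<longlongrightarrow> \<phi> z) (at_right 0)"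
      by (rule continuous_on_tendsto_compose[OF \<phi>(1) _ z])
        (rule eventually_mono[OF near0], rule wK)
    then have "((\<lambda>t. ereal (\<phi> (w t) - \<phi> y)) \<longlongrightarrow> ereal (\<phi> z - \<phi> y)) (at_right 0)"
      by (intro tendsto_intros)
    then have "ereal (\<phi> z - \<phi> y) = Limsup (at_right 0) (\<lambda>t. ereal (\<phi> (w t) - \<phi> y))"
      by (intro lim_imp_Limsup[symmetric]) simp
    also have "\<dots> \<le> Limsup (at_right 0) (\<lambda>t. ereal (f (w t) y))"
      by (rule Limsup_mono[OF eventually_mono[OF near0]]) (simp add: lower)
    also have "\<dots> \<le> ereal (f z y)"
      using hemicontinuous[OF y] z y by (auto simp: upper_hemicontinuous_on_def w_def)
    finally show "\<phi> z \<le> f z y + \<phi> y" by simp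
  qed
qed

text \<open>
  This is where the fixed point property enters. Suppose that each point \<open>z\<close> of the closed hull of \<open>E\<close>
  violates the inequality for some \<open>y \<in> E\<close>. Weighting each \<open>y\<close> by the distance of \<open>z\<close> from the set \<open>C y\<close>
  gives a continuous map of the hull into itself, whose value at \<open>z\<close> is a combination of only those
  \<open>y\<close> whose inequality fails at \<open>z\<close>. By monotonicity they satisfy \<open>f z y + \<phi> y < \<phi> z\<close>, a convex condition,
  which at a fixed point would hold for \<open>y = z\<close>.
\<close>

lemma finite_dual_solution:
  assumes fpp: "convex_hull_finite_property TYPE('a)"
    and E: "finite E" "E \<noteq> {}" "E \<subseteq> K"
    and \<phi>: "continuous_on K \<phi>" "geo_convex_on K \<phi>"
  shows "\<exists>z\<in>K. \<forall>y\<in>E. f y z + \<phi> z \<le> \<phi> y"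
proof (rule ccontr)
  assume contra: "\<not> ?thesis"
  define C where "C y = {z \<in> K. f y z + \<phi> z \<le> \<phi> y}" for y
  define S where "S = closed_geo_hull E"
  have C: "closed (C y)" "y \<in> C y" if "y \<in> E" for y
    using that E diagonal by (auto simp: C_def intro!: closed_sublevel_add_continuous closed_K lsc \<phi>)
  have SK: "S \<subseteq> K"
    unfolding S_def closed_geo_hull_def
    by (intro closure_minimal geo_hull_minimal E convex_K closed_K)
  define l where "l y z = infdist z (C y)" for y z
  have l_pos: "l y z > 0 \<longleftrightarrow> z \<notin> C y" if "y \<in> E" for y z
    using in_closed_iff_infdist_zero[OF C(1)[OF that], of z] C(2)[OF that] infdist_nonneg[of z "C y"]
    by (auto simp: l_def less_le)
  have l_nn: "l y z \<ge> 0" for y z by (simp add: l_def infdist_nonneg)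
  have S_pos: "(\<Sum>y\<in>E. l y z) > 0" if z: "z \<in> S" for z
  proof -
    obtain y where "y \<in> E" "z \<notin> C y" using contra z SK by (auto simp: C_def)
    then show ?thesis using l_pos E(1) l_nn by (intro sum_pos2[of E y]) auto
  qed
  have "continuous_on UNIV (l y)" for y
    unfolding l_def by (intro continuous_on_infdist continuous_on_id)
  then obtain h where h: "continuous_on {z. (\<Sum>y\<in>E. l y z) > 0} h"
    and hull: "\<And>z A. (\<Sum>y\<in>E. l y z) > 0 \<Longrightarrow> geo_convex A \<Longrightarrow> {y\<in>E. l y z > 0} \<subseteq> A \<Longrightarrow> h z \<in> A"
    using continuous_convex_combination[OF cat E(1), of l] l_nn by blast
  have "continuous_on S h" using S_pos by (intro continuous_on_subset[OF h]) auto
  moreover have "h z \<in> S" if "z \<in> S" for z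
  proof -
    have "h z \<in> geo_hull E"
      using geo_hull_superset by (intro hull S_pos that geo_convex_geo_hull unique_geodesics) blast
    then show ?thesis using closure_subset by (auto simp: S_def closed_geo_hull_def)
  qed
  ultimately obtain z where z: "z \<in> S" "h z = z"
    using fpp E unfolding convex_hull_finite_property_def S_def by (metis image_subsetI)
  then have zK: "z \<in> K" using SK by blast
  define A where "A = {u \<in> K. f z u + \<phi> u < \<phi> z}"
  have "geo_convex A"
    unfolding A_def
    by (intro geo_convex_sublevel(2) unique_geodesics convex_K geo_convex_on_add conv zK \<phi>)
  moreover have "{y\<in>E. l y z > 0} \<subseteq> A"
  proof
    fix y assume "y \<in> {y\<in>E. l y z > 0}"
    then have y: "y \<in> K" "\<not> f y z + \<phi> z \<le> \<phi> y" using l_pos E zK by (auto simp: C_def)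
    then show "y \<in> A" using monotone[OF zK y(1)] by (simp add: A_def)
  qed
  ultimately have "h z \<in> A" by (intro hull S_pos z)
  then show False using z(2) diagonal[OF zK] by (simp add: A_def)
qed

text \<open>
  By lower semicontinuity \<open>f y\<close> is greater than \<open>-1\<close> on a small ball about \<open>y\<close>, where \<open>f y y = 0\<close>.
  Convexity along the geodesic from \<open>y\<close> to \<open>z\<close> then bounds \<open>f y z\<close> below by a linear function
  of \<open>d(y, z)\<close>, which \<open>cosh d(x, z)\<close> outgrows.
\<close>

lemma bounded_dual_sublevel:
  assumes y: "y \<in> K"
  shows "bounded {z \<in> K. f y z + cosh (dist x z) \<le> cosh (dist x y)}"
proof -
  define N where "N = {w \<in> K. f y w \<le> -1}"
  have "closed N"
    using lsc[OF y] closed_K closedin_closed_trans unfolding lsc_on_def N_def by blast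
  moreover have "y \<notin> N" using diagonal[OF y] by (simp add: N_def)
  ultimately obtain \<delta> where \<delta>: "\<delta> > 0" "ball y \<delta> \<subseteq> - N"
    using open_contains_ball[of "- N"] by blast
  define r where "r = \<delta> / 2"
  have r: "r > 0" using \<delta>(1) by (simp add: r_def)
  have above: "f y w > -1" if "w \<in> K" "dist y w \<le> r" for w
  proof -
    have "w \<in> ball y \<delta>" using that(2) \<delta>(1) by (simp add: r_def)
    then show "f y w > -1" using \<delta>(2) that(1) by (auto simp: N_def)
  qed
  have low: "f y z \<ge> - (1 + dist y z / r)" if z: "z \<in> K" for z
  proof (cases "dist y z \<le> r")
    case True
    then have "f y z > -1" by (intro above z)
    moreover have "0 \<le> dist y z / r" using r by simp
    ultimately show ?thesis by simp
  next
    case False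
    define t where "t = r / dist y z"
    have far: "0 < dist y z" "r < dist y z" using False r by linarith+
    then have t: "0 < t" "t < 1" using r by (simp_all only: t_def divide_pos_pos divide_less_eq_1_pos)
    have "dist y (geo_comb (1 - t) y z) = r"
      using comb(2)[of "1 - t" y z] t far(1) by (simp add: t_def)
    then have "-1 < f y (geo_comb (1 - t) y z)"
      using t by (intro above comb_in_K y z) auto
    also have "\<dots> \<le> (1 - t) * f y y + (1 - (1 - t)) * f y z"
      using t by (intro geo_convex_on_le[OF unique_geodesics conv[OF y] y z]) auto
    finally have "-1 < r * f y z / dist y z" using diagonal[OF y] by (simp add: t_def)
    then have "- (dist y z / r) < f y z"
      using far(1) r by (simp add: field_simps)
    then show ?thesis by simp
  qed
  define M where "M = cosh (dist x y) + 1 + dist x y / r"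
  have "dist x z \<le> M + 1 / r\<^sup>2"
    if z: "z \<in> K" "f y z + cosh (dist x z) \<le> cosh (dist x y)" for z
  proof -
    have "dist y z \<le> dist x y + dist x z" by (metric)
    then have "dist y z / r \<le> dist x y / r + dist x z / r"
      using r by (simp add: divide_right_mono flip: add_divide_distrib)
    then have "cosh (dist x z) \<le> M + dist x z / r" using z low[OF z(1)] by (simp add: M_def)
    then have "1 + (dist x z)\<^sup>2 / 2 \<le> M + dist x z / r"
      using cosh_ge_quadratic[of "dist x z"] by linarith
    \<comment> \<open>Completing squares absorbs the two terms that are linear in the distance.\<close>
    moreover have "0 \<le> (dist x z / 2 - 1 / r)\<^sup>2" "0 \<le> (dist x z / 2 - 1)\<^sup>2" by simp_all
    ultimately show ?thesis by (simp add: power2_eq_square algebra_simps)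
  qed
  then show ?thesis unfolding bounded_def by blast
qed

lemma cosh_dist_continuous_convex:
  "continuous_on K (\<lambda>y. cosh (dist x y))" "geo_convex_on K (\<lambda>y. cosh (dist x y))"
proof -
  show "continuous_on K (\<lambda>y. cosh (dist x y))" by (intro continuous_intros)
  show "geo_convex_on K (\<lambda>y. cosh (dist x y))"
    using CAT_minus1_cosh_convex[OF cat] by (auto simp: geo_convex_on_def)
qed

lemma in_resolvent_iff:
  "z \<in> resolvent K f x \<longleftrightarrow> z \<in> K \<and> (\<forall>y\<in>K. cosh (dist x z) \<le> f z y + cosh (dist x y))"
proof -
  have "0 \<le> ereal (f z y + cosh (dist x y) - cosh (dist x z))
      \<longleftrightarrow> cosh (dist x z) \<le> f z y + cosh (dist x y)" for y by (auto simp: zero_ereal_def)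
  then show ?thesis by (simp add: resolvent_def le_INF_iff)
qed

lemma in_Equil_iff: "z \<in> Equil K f \<longleftrightarrow> z \<in> K \<and> (\<forall>y\<in>K. 0 \<le> f z y)"
  by (simp add: Equil_def le_INF_iff)

text \<open>
  The dual sets have the finite intersection property, and a point common to all of them
  is a resolvent point by Minty's argument.
\<close>

lemma resolvent_nonempty:
  assumes fpp: "convex_hull_finite_property TYPE('a)" and K: "K \<noteq> {}"
  shows "resolvent K f x \<noteq> {}"
proof -
  define C where "C y = {z \<in> K. f y z + cosh (dist x z) \<le> cosh (dist x y)}" for y
  obtain y0 where y0: "y0 \<in> K" using K by blast
  have "\<Inter>(C ` K) \<noteq> {}"
  proof (rule closed_geo_convex_Inter_nonempty[OF cat])
    fix \<F> assume "finite \<F>" "\<F> \<subseteq> C ` K"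
    then obtain E where E: "finite E" "E \<subseteq> K" "\<F> = C ` E" by (meson finite_subset_image)
    then obtain z where "z \<in> K" "\<forall>y\<in>insert y0 E. f y z + cosh (dist x z) \<le> cosh (dist x y)"
      using finite_dual_solution[OF fpp, of "insert y0 E" "\<lambda>y. cosh (dist x y)"]
        cosh_dist_continuous_convex y0 by blast
    then show "\<Inter>\<F> \<noteq> {}" using E by (auto simp: C_def)
  next
    show "C y0 \<in> C ` K" using y0 by blast
    show "bounded (C y0)" unfolding C_def by (rule bounded_dual_sublevel[OF y0])
  qed (auto simp: C_def intro!: closed_sublevel_add_continuous geo_convex_sublevel(1)
      geo_convex_on_add closed_K lsc conv convex_K unique_geodesics cosh_dist_continuous_convex)
  then obtain z where z: "\<And>y. y \<in> K \<Longrightarrow> z \<in> C y" by blast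
  then have "z \<in> K" "\<forall>y\<in>K. f y z + cosh (dist x z) \<le> cosh (dist x y)"
    using y0 by (auto simp: C_def)
  then have "z \<in> resolvent K f x"
    using Minty[OF cosh_dist_continuous_convex] by (simp add: in_resolvent_iff)
  then show ?thesis by blast
qed

section \<open>Uniqueness and the nonspreading inequality\<close>

text \<open>
  This is the first-order optimality condition at \<open>z\<close> in the direction of \<open>w\<close>. Testing the resolvent
  inequality at \<open>(1 - t) z \<oplus> t w\<close> shows that the function \<open>G\<close> below, which vanishes at \<open>0\<close>, is
  nonnegative for small \<open>t > 0\<close>; its derivative at \<open>0\<close> is the difference of the two sides.
\<close>

lemma resolvent_variational_inequality:
  assumes z: "z \<in> resolvent K f x" and w: "w \<in> K"
  shows "dist z w * (cosh (dist z w) * cosh (dist x z) - cosh (dist x w)) \<le> f z w * sinh (dist z w)"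
proof -
  define D a b where "D = dist z w" and "a = cosh (dist x z)" and "b = cosh (dist x w)"
  have zK: "z \<in> K" using z by (simp add: in_resolvent_iff)
  define G where "G t = t * f z w * sinh D + (sinh ((1 - t) * D) - sinh D) * a + sinh (t * D) * b" for t
  have G: "0 \<le> G t" if t: "0 < t" "t < 1" for t
  proof -
    define m where "m = geo_comb (1 - t) z w"
    have t': "1 - t \<in> {0..1}" using t by auto
    have "f z m \<le> t * f z w"
      using geo_convex_on_le[OF unique_geodesics conv[OF zK] zK w t'] diagonal[OF zK]
      by (simp add: m_def)
    moreover have "a \<le> f z m + cosh (dist x m)"
      using z comb_in_K[OF zK w t'] by (simp add: in_resolvent_iff a_def m_def)
    ultimately have "a * sinh D \<le> (t * f z w + cosh (dist x m)) * sinh D"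
      by (intro mult_right_mono) (auto simp: D_def)
    moreover have "sinh D * cosh (dist x m) \<le> sinh ((1 - t) * D) * a + sinh (t * D) * b"
      using CAT_minus1_cosh_inequality[OF cat t', of z w x] by (simp add: D_def a_def b_def m_def)
    ultimately show ?thesis by (simp add: G_def algebra_simps)
  qed
  have "(G has_real_derivative (f z w * sinh D - D * cosh D * a + D * b)) (at 0)"
    unfolding G_def by (auto intro!: derivative_eq_intros)
  moreover have "G 0 = 0" by (simp add: G_def)
  ultimately have "\<not> f z w * sinh D - D * cosh D * a + D * b < 0"
    using DERIV_neg_dec_right[of G _ 0] G
    by (metis add.left_neutral field_lbound_gt_zero linorder_not_le zero_less_one)
  then show ?thesis by (simp add: D_def a_def b_def algebra_simps)
qed

text \<open>
  In the sum of the two optimality conditions, for \<open>z\<close> towards \<open>w\<close> and for \<open>w\<close> towards \<open>z\<close>,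
  monotonicity of \<open>f\<close> makes the right side nonpositive, and the factor \<open>d(z, w)\<close> cancels.
\<close>

lemma resolvent_nonspreading:
  assumes z: "z \<in> resolvent K f x" and w: "w \<in> resolvent K f y"
  shows "(cosh (dist x z) + cosh (dist y w)) * cosh (dist z w)
           \<le> cosh (dist z y) + cosh (dist x w)"
proof (cases "z = w")
  case False
  define D where "D = dist z w"
  have D: "D > 0" using False by (simp add: D_def)
  have K: "z \<in> K" "w \<in> K" using z w by (simp_all add: in_resolvent_iff)
  have "D * (cosh D * cosh (dist x z) - cosh (dist x w)) \<le> f z w * sinh D"
    and "D * (cosh D * cosh (dist y w) - cosh (dist y z)) \<le> f w z * sinh D"
    using resolvent_variational_inequality[OF z K(2)] resolvent_variational_inequality[OF w K(1)]
    by (simp_all add: D_def dist_commute)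
  then have "D * ((cosh (dist x z) + cosh (dist y w)) * cosh D - (cosh (dist z y) + cosh (dist x w)))
      \<le> (f z w + f w z) * sinh D"
    by (simp add: algebra_simps dist_commute)
  also have "\<dots> \<le> 0" using monotone[OF K] D by (simp add: mult_nonpos_nonneg)
  finally show ?thesis using D by (simp add: mult_le_0_iff D_def)
qed (simp add: dist_commute)

lemma resolvent_unique:
  assumes z: "z \<in> resolvent K f x" and w: "w \<in> resolvent K f x"
  shows "z = w"
proof -
  define s where "s = cosh (dist x z) + cosh (dist x w)"
  have "s > 0" by (simp add: s_def add_pos_pos)
  moreover have "s * cosh (dist z w) \<le> s * 1"
    using resolvent_nonspreading[OF z w] by (simp add: s_def dist_commute)
  ultimately have "cosh (dist z w) \<le> cosh 0" by simp
  then show ?thesis by (subst (asm) cosh_real_nonneg_le_iff) auto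
qed

text \<open>
  For \<open>x = z\<close> the perturbation \<open>cosh d(z, y) - 1\<close> is nonnegative and vanishes to second order at
  \<open>z\<close>: it does no harm to an equilibrium, and it disappears from the first-order condition.
\<close>

lemma Equil_iff_resolvent_fixed: "z \<in> Equil K f \<longleftrightarrow> z \<in> resolvent K f z"
proof
  assume "z \<in> Equil K f"
  then have "z \<in> K" "\<And>y. y \<in> K \<Longrightarrow> 0 \<le> f z y" by (auto simp: in_Equil_iff)
  then show "z \<in> resolvent K f z"
    using cosh_real_ge_1[of "dist z _"] by (force simp: in_resolvent_iff intro: add_increasing)
next
  assume z: "z \<in> resolvent K f z"
  then have zK: "z \<in> K" by (simp add: in_resolvent_iff)
  have "0 \<le> f z y" if y: "y \<in> K" for y
  proof (cases "y = z")
    case False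
    have "0 \<le> f z y * sinh (dist z y)" using resolvent_variational_inequality[OF z y] by simp
    then show ?thesis using False by (simp add: zero_le_mult_iff)
  qed (simp add: diagonal zK)
  then show "z \<in> Equil K f" using zK by (simp add: in_Equil_iff)
qed

text \<open>
  The dual form of the problem exposes the equilibria as common points of sublevel sets of the
  functions \<open>f y\<close>, whereas \<open>f z y\<close> is merely hemicontinuous in \<open>z\<close>.
\<close>

lemma closed_convex_Equil: "closed (Equil K f)" "geo_convex (Equil K f)"
proof -
  have 0: "continuous_on K (\<lambda>_. 0::real)" "geo_convex_on K (\<lambda>_. 0)"
    by (simp_all add: geo_convex_on_def)
  have eq: "Equil K f = \<Inter>(insert K ((\<lambda>y. {z \<in> K. f y z \<le> 0}) ` K))"
    using Minty[OF 0] by (auto simp: in_Equil_iff)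
  show "closed (Equil K f)"
    unfolding eq using closed_sublevel_add_continuous[OF closed_K lsc 0(1), of _ 0] closed_K
    by (intro closed_Inter) auto
  show "geo_convex (Equil K f)"
    unfolding eq using convex_K conv
    by (intro geo_convex_Inter) (auto intro!: geo_convex_sublevel(1) unique_geodesics)
qed

end

section \<open>The resolvent as a map\<close>

theorem theorem3p1:
  fixes K :: "'a::complete_space set" and f :: "'a \<Rightarrow> 'a \<Rightarrow> real"
  assumes "CAT_minus1 TYPE('a)"
    and "convex_hull_finite_property TYPE('a)"
    and "K \<noteq> {}" and "closed K" and "geo_convex K"
    and a: "\<And>x. x \<in> K \<Longrightarrow> f x x = 0"
    and b: "\<And>x y. x \<in> K \<Longrightarrow> y \<in> K \<Longrightarrow> f x y + f y x \<le> 0"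
    and c: "\<And>x. x \<in> K \<Longrightarrow> lsc_on K (\<lambda>y. f x y) \<and> geo_convex_on K (\<lambda>y. f x y)"
    and d: "\<And>y. y \<in> K \<Longrightarrow> upper_hemicontinuous_on K (\<lambda>x. f x y)"
  shows "effective_domain (resolvent K f) = UNIV \<and>
         (single_valued_map (resolvent K f) \<and>
          firmly_hyperbolically_nonspreading (the_elem \<circ> resolvent K f)) \<and>
         (Equil K f = fixed_points (the_elem \<circ> resolvent K f) \<and>
          closed (Equil K f) \<and> geo_convex (Equil K f))"
proof -
  interpret equilibrium_problem K f
    using assms by unfold_locales auto
  define T where "T = the_elem \<circ> resolvent K f"
  have R: "resolvent K f x = {T x}" for x
  proof -
    obtain z where z: "z \<in> resolvent K f x" using resolvent_nonempty[OF assms(2,3)] by blast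
    then have "resolvent K f x = {z}" using resolvent_unique by blast
    then show ?thesis by (simp add: T_def)
  qed
  have "firmly_hyperbolically_nonspreading T"
    unfolding firmly_hyperbolically_nonspreading_def using resolvent_nonspreading R by blast
  moreover have "Equil K f = fixed_points T"
    using Equil_iff_resolvent_fixed R by (auto simp: fixed_points_def)
  ultimately show ?thesis
    using R closed_convex_Equil
    by (auto simp: effective_domain_def single_valued_map_def simp flip: T_def)
qed

end
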